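(* Let $p$ be any prime. The action of $\mathrm{Aut}(G_{(1,0)}^{(p)})$ on $\mathrm{End}(G_{(1,0)}^{(p)})$ via conjugation, where $\alpha\in\mathrm{Aut}(G_{(1,0)}^{(p)})$ acts by $\varphi\mapsto\alpha\circ\varphi\circ\alpha^{-1}$, has exactly $3p^{16}-p^{12}$ orbits, of which $2p^{16}$ have length $1$ and $p^{12}(p^4-1)$ have length $p^4$.
   Context: For a prime $p$, the JK-group $G_{(1,0)}^{(p)}$ is the group generated by $a_1,a_2,b_1,b_2$ subject to the relations stating that it is nilpotent of class (at most) $2$ (all commutators are central) together with $$a_1^p=[a_1,b_1],\quad a_2^p=[a_1,b_1],\quad b_1^p=[a_2,b_1b_2],\quad b_2^p=[a_2,b_2],\quad [a_1,a_2]=[b_1,b_2]=1.$$ It is a $p$-group of order $p^8$. $\mathrm{Aut}(G)$ is the automorphism group of $G$, i.e. the group of units of the monoid $\mathrm{End}(G)$ of all endomorphisms of $G$ under composition. *)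

theory Defs
  imports "HOL-Computational_Algebra.Primes" "HOL-Algebra.Group_Action"
begin

section \<open>Groups given by generators and relations\<close>

text \<open>
  A word is a list of letters; \<open>(x, True)\<close> stands for the generator \<open>x\<close> and
  \<open>(x, False)\<close> for its formal inverse.  A relation \<open>u = v\<close> is the pair \<open>(u, v)\<close>.
\<close>

type_synonym 'a word = "('a \<times> bool) list"

definition gen :: "'a \<Rightarrow> 'a word"
  where "gen x = [(x, True)]"

definition word_inv :: "'a word \<Rightarrow> 'a word"
  where "word_inv w = rev (map (\<lambda>(x, s). (x, \<not> s)) w)"

definition word_pow :: "'a word \<Rightarrow> nat \<Rightarrow> 'a word"
  where "word_pow w n = concat (replicate n w)"

text \<open>
  The convention is \<open>[u, v] = u\<inverse> v\<inverse> u v\<close>.  In a group of class at most 2 this equals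
  \<open>u v u\<inverse> v\<inverse>\<close>, so the presentation below does not depend on the choice.
\<close>

definition word_comm :: "'a word \<Rightarrow> 'a word \<Rightarrow> 'a word"
  where "word_comm u v = word_inv u @ word_inv v @ u @ v"

text \<open>
  The least congruence on words that contains the relations and free cancellation.
\<close>

inductive word_eq :: "('a word \<times> 'a word) set \<Rightarrow> 'a word \<Rightarrow> 'a word \<Rightarrow> bool"
  for R :: "('a word \<times> 'a word) set"
  where
    rel: "(u, v) \<in> R \<Longrightarrow> word_eq R u v"
  | cancel: "word_eq R [(x, s), (x, \<not> s)] []"
  | append: "word_eq R u u' \<Longrightarrow> word_eq R v v' \<Longrightarrow> word_eq R (u @ v) (u' @ v')"
  | refl: "word_eq R u u"
  | sym: "word_eq R u v \<Longrightarrow> word_eq R v u"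
  | trans: "word_eq R u v \<Longrightarrow> word_eq R v w \<Longrightarrow> word_eq R u w"

definition word_class :: "('a word \<times> 'a word) set \<Rightarrow> 'a word \<Rightarrow> 'a word set"
  where "word_class R u = {v. word_eq R u v}"

definition presented_group :: "('a word \<times> 'a word) set \<Rightarrow> 'a word set monoid"
  where "presented_group R =
    \<lparr>carrier = range (word_class R),
     mult = \<lambda>X Y. \<Union>u\<in>X. \<Union>v\<in>Y. word_class R (u @ v),
     one = word_class R []\<rparr>"

lemma word_class_eq_iff: "word_class R u = word_class R v \<longleftrightarrow> word_eq R u v"
  unfolding word_class_def by (auto intro: word_eq.intros)

lemma presented_group_simps:
  "carrier (presented_group R) = range (word_class R)"
  "\<one>\<^bsub>presented_group R\<^esub> = word_class R []"
  by (simp_all add: presented_group_def)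

lemma presented_group_mult:
  "word_class R u \<otimes>\<^bsub>presented_group R\<^esub> word_class R v = word_class R (u @ v)"
proof -
  have "word_class R (u' @ v') = word_class R (u @ v)"
    if "u' \<in> word_class R u" "v' \<in> word_class R v" for u' v'
    using that unfolding word_class_eq_iff
    by (auto simp: word_class_def intro: word_eq.sym word_eq.append)
  moreover have "word_class R u \<noteq> {}" "word_class R v \<noteq> {}"
    by (auto simp: word_class_def intro: word_eq.refl)
  ultimately show ?thesis
    unfolding presented_group_def by (simp cong: SUP_cong_simp)
qed

lemma word_eq_inv_left: "word_eq R (word_inv u @ u) []"
proof (induction u)
  case Nil
  show ?case by (simp add: word_inv_def word_eq.refl)
next
  case (Cons a u)
  obtain x s where a: "a = (x, s)" by (cases a)
  have "word_eq R ([(x, \<not> s)] @ [(x, s)]) []"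
    using word_eq.cancel[of R x "\<not> s"] by simp
  then have "word_eq R (word_inv u @ ([(x, \<not> s)] @ [(x, s)]) @ u) (word_inv u @ [] @ u)"
    by (intro word_eq.append word_eq.refl)
  then show ?case
    using Cons.IH a by (auto simp: word_inv_def intro: word_eq.trans)
qed

lemma group_presented_group: "group (presented_group R)"
proof (rule groupI)
  show "\<exists>y\<in>carrier (presented_group R). y \<otimes>\<^bsub>presented_group R\<^esub> x = \<one>\<^bsub>presented_group R\<^esub>"
    if "x \<in> carrier (presented_group R)" for x
  proof -
    from that obtain u where "x = word_class R u"
      by (auto simp: presented_group_simps)
    then have "word_class R (word_inv u) \<otimes>\<^bsub>presented_group R\<^esub> x = \<one>\<^bsub>presented_group R\<^esub>"
      by (simp add: presented_group_mult presented_group_simps word_class_eq_iff word_eq_inv_left)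
    then show ?thesis by (auto simp: presented_group_simps)
  qed
qed (auto simp: presented_group_simps presented_group_mult)

definition word_eval :: "('b, 'c) monoid_scheme \<Rightarrow> ('a \<Rightarrow> 'b) \<Rightarrow> 'a word \<Rightarrow> 'b"
  where "word_eval H f w =
    foldr (\<lambda>(x, s) y. (if s then f x else inv\<^bsub>H\<^esub> (f x)) \<otimes>\<^bsub>H\<^esub> y) w \<one>\<^bsub>H\<^esub>"

context group
begin

lemma word_eval_closed:
  assumes "f \<in> UNIV \<rightarrow> carrier G"
  shows "word_eval G f w \<in> carrier G"
  using assms by (induction w) (auto simp: word_eval_def Pi_iff)

lemma word_eval_append:
  assumes "f \<in> UNIV \<rightarrow> carrier G"
  shows "word_eval G f (u @ v) = word_eval G f u \<otimes> word_eval G f v"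
proof (induction u)
  case Nil
  then show ?case using word_eval_closed[OF assms, of v] by (simp add: word_eval_def)
next
  case (Cons a u)
  then show ?case
    using word_eval_closed[OF assms, of u] word_eval_closed[OF assms, of v] assms
    by (cases a) (auto simp: word_eval_def Pi_iff m_assoc)
qed

lemma word_eval_cong:
  assumes f: "f \<in> UNIV \<rightarrow> carrier G"
    and R: "\<And>u v. (u, v) \<in> R \<Longrightarrow> word_eval G f u = word_eval G f v"
    and "word_eq R u v"
  shows "word_eval G f u = word_eval G f v"
  using assms(3)
proof induction
  case (cancel x s)
  then show ?case using f by (auto simp: word_eval_def Pi_iff)
qed (auto simp: R word_eval_append[OF f])

theorem presented_group_universal:
  assumes f: "f \<in> UNIV \<rightarrow> carrier G"
    and R: "\<And>u v. (u, v) \<in> R \<Longrightarrow> word_eval G f u = word_eval G f v"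
  shows "\<exists>h \<in> hom (presented_group R) G. \<forall>x. h (word_class R (gen x)) = f x"
proof -
  define h where "h X = word_eval G f (SOME w. w \<in> X)" for X
  have h: "h (word_class R u) = word_eval G f u" for u
  proof -
    have "u \<in> word_class R u" by (simp add: word_class_def word_eq.refl)
    then have "(SOME w. w \<in> word_class R u) \<in> word_class R u" by (rule someI)
    then have "word_eq R u (SOME w. w \<in> word_class R u)" by (simp add: word_class_def)
    then show ?thesis unfolding h_def using word_eval_cong[OF f R] by metis
  qed
  have "h \<in> hom (presented_group R) G"
    by (rule homI)
      (auto simp: presented_group_simps presented_group_mult h word_eval_closed[OF f]
        word_eval_append[OF f])
  moreover have "h (word_class R (gen x)) = f x" for x
    using f by (auto simp: h gen_def word_eval_def Pi_iff)
  ultimately show ?thesis by blast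
qed

end


section \<open>The JK-groups with parameters (1,0)\<close>

datatype jk_gen = A1 | A2 | B1 | B2

definition class2_rels :: "('a word \<times> 'a word) set"
  where "class2_rels = {(word_comm u v @ w, w @ word_comm u v) | u v w. True}"

definition JK_rels :: "nat \<Rightarrow> (jk_gen word \<times> jk_gen word) set"
  where "JK_rels p = class2_rels \<union>
    {(word_pow (gen A1) p, word_comm (gen A1) (gen B1)),
     (word_pow (gen A2) p, word_comm (gen A1) (gen B1)),
     (word_pow (gen B1) p, word_comm (gen A2) (gen B1 @ gen B2)),
     (word_pow (gen B2) p, word_comm (gen A2) (gen B2)),
     (word_comm (gen A1) (gen A2), []),
     (word_comm (gen B1) (gen B2), [])}"

definition JK_group :: "nat \<Rightarrow> jk_gen word set monoid"
  where "JK_group p = presented_group (JK_rels p)"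

lemma group_JK_group: "group (JK_group p)"
  unfolding JK_group_def by (rule group_presented_group)


section \<open>Endomorphisms, automorphisms and conjugation\<close>

text \<open>
  Endomorphisms are taken to be extensional, so that each endomorphism of the carrier is
  represented by exactly one HOL function.
\<close>

definition End_monoid :: "('a, 'b) monoid_scheme \<Rightarrow> ('a \<Rightarrow> 'a) monoid"
  where "End_monoid G =
    \<lparr>carrier = hom G G \<inter> extensional (carrier G),
     mult = compose (carrier G),
     one = \<lambda>x\<in>carrier G. x\<rparr>"

abbreviation Aut_group :: "('a, 'b) monoid_scheme \<Rightarrow> ('a \<Rightarrow> 'a) monoid"
  where "Aut_group G \<equiv> units_of (End_monoid G)"

definition unit_conj :: "('a, 'b) monoid_scheme \<Rightarrow> 'a \<Rightarrow> 'a \<Rightarrow> 'a"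
  where "unit_conj M \<alpha> = (\<lambda>\<phi>\<in>carrier M. \<alpha> \<otimes>\<^bsub>M\<^esub> \<phi> \<otimes>\<^bsub>M\<^esub> inv\<^bsub>M\<^esub> \<alpha>)"

lemma (in monoid) monoid_End_monoid: "monoid (End_monoid G)"
proof (rule monoidI)
  show "x \<otimes>\<^bsub>End_monoid G\<^esub> y \<in> carrier (End_monoid G)"
    if "x \<in> carrier (End_monoid G)" "y \<in> carrier (End_monoid G)" for x y
    using that by (auto simp: End_monoid_def hom_def compose_def Pi_iff)
  show "\<one>\<^bsub>End_monoid G\<^esub> \<in> carrier (End_monoid G)"
    by (auto simp: End_monoid_def hom_def)
qed (auto simp: End_monoid_def hom_def compose_assoc[symmetric])

text \<open>The units of the endomorphism monoid are the automorphisms of the library.\<close>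

lemma (in group) carrier_Aut_group: "carrier (Aut_group G) = carrier (AutoGroup G)"
proof
  show "carrier (Aut_group G) \<subseteq> carrier (AutoGroup G)"
  proof
    fix f assume "f \<in> carrier (Aut_group G)"
    then obtain g where f: "f \<in> hom G G" "f \<in> extensional (carrier G)"
      and g: "g \<in> hom G G"
      and inv: "compose (carrier G) g f = (\<lambda>x\<in>carrier G. x)"
        "compose (carrier G) f g = (\<lambda>x\<in>carrier G. x)"
      by (auto simp: units_of_def Units_def End_monoid_def)
    have "bij_betw f (carrier G) (carrier G)"
    proof (rule bij_betw_byWitness[of _ g])
      show "\<forall>x\<in>carrier G. g (f x) = x" "\<forall>x\<in>carrier G. f (g x) = x"
        using inv by (metis compose_eq restrict_apply')+
    qed (use f g in \<open>auto simp: hom_def\<close>)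
    then show "f \<in> carrier (AutoGroup G)"
      using f by (simp add: AutoGroup_def auto_def Bij_def)
  qed
  show "carrier (AutoGroup G) \<subseteq> carrier (Aut_group G)"
  proof
    fix f assume "f \<in> carrier (AutoGroup G)"
    then have f: "f \<in> hom G G" "f \<in> Bij (carrier G)"
      by (simp_all add: AutoGroup_def auto_def)
    let ?g = "restrict (inv_into (carrier G) f) (carrier G)"
    have "?g \<in> hom G G \<inter> extensional (carrier G)"
      using restrict_inv_into_hom[OF f] by simp
    moreover have "compose (carrier G) ?g f = (\<lambda>x\<in>carrier G. x)"
      by (rule Bij_compose_restrict_eq[OF f(2)])
    moreover have "compose (carrier G) f ?g = (\<lambda>x\<in>carrier G. x)"
      using f(2) by (intro compose_id_inv_into) (auto simp: Bij_def bij_betw_def)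
    ultimately show "f \<in> carrier (Aut_group G)"
      using f by (auto simp: units_of_def Units_def End_monoid_def Bij_def)
  qed
qed

lemma (in monoid) unit_conj_closed:
  assumes "a \<in> Units G" "x \<in> carrier G"
  shows "unit_conj G a x \<in> carrier G"
  using assms by (simp add: unit_conj_def Units_closed)

lemma (in monoid) unit_conj_mult:
  assumes a: "a \<in> Units G" and b: "b \<in> Units G" and x: "x \<in> carrier G"
  shows "unit_conj G (a \<otimes> b) x = unit_conj G a (unit_conj G b x)"
proof -
  have "(a \<otimes> b) \<otimes> (inv b \<otimes> inv a) = a \<otimes> (b \<otimes> inv b) \<otimes> inv a"
    "(inv b \<otimes> inv a) \<otimes> (a \<otimes> b) = inv b \<otimes> (inv a \<otimes> a) \<otimes> b"
    using a b by (simp_all only: m_assoc Units_closed Units_inv_closed m_closed)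
  then have "inv (a \<otimes> b) = inv b \<otimes> inv a"
    using a b by (intro inv_unique'[symmetric]) (simp_all add: Units_closed)
  then show ?thesis using assms by (simp add: unit_conj_def m_assoc Units_closed)
qed

lemma (in monoid) unit_conj_one:
  "x \<in> carrier G \<Longrightarrow> unit_conj G \<one> x = x"
  by (simp add: unit_conj_def)

theorem (in monoid) group_action_unit_conj:
  "group_action (units_of G) (carrier G) (unit_conj G)"
proof -
  have bij: "unit_conj G a \<in> Bij (carrier G)" if a: "a \<in> Units G" for a
  proof -
    have "bij_betw (unit_conj G a) (carrier G) (carrier G)"
    proof (rule bij_betw_byWitness[of _ "unit_conj G (inv a)"])
      show "\<forall>x\<in>carrier G. unit_conj G (inv a) (unit_conj G a x) = x"
        "\<forall>x\<in>carrier G. unit_conj G a (unit_conj G (inv a) x) = x"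
        using a by (simp_all add: unit_conj_one flip: unit_conj_mult)
    qed (use a in \<open>auto simp: unit_conj_closed\<close>)
    then show ?thesis by (simp add: Bij_def unit_conj_def)
  qed
  have "unit_conj G \<in> hom (units_of G) (BijGroup (carrier G))"
  proof (rule homI)
    fix a b assume "a \<in> carrier (units_of G)" "b \<in> carrier (units_of G)"
    then have ab: "a \<in> Units G" "b \<in> Units G" by (simp_all add: units_of_carrier)
    have "unit_conj G (a \<otimes> b) = compose (carrier G) (unit_conj G a) (unit_conj G b)"
    proof (rule extensionalityI[of _ "carrier G"])
      show "unit_conj G (a \<otimes> b) \<in> extensional (carrier G)" by (simp add: unit_conj_def)
    qed (use ab in \<open>auto simp: compose_eq unit_conj_mult\<close>)
    then show "unit_conj G (a \<otimes>\<^bsub>units_of G\<^esub> b)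
        = unit_conj G a \<otimes>\<^bsub>BijGroup (carrier G)\<^esub> unit_conj G b"
      using ab by (simp add: BijGroup_def bij units_of_mult)
  qed (auto simp: BijGroup_def bij units_of_carrier)
  then show ?thesis
    by (simp add: group_action_def group_hom_def group_hom_axioms_def units_group group_BijGroup)
qed

lemma group_action_JK_group:
  "group_action (Aut_group (JK_group p)) (carrier (End_monoid (JK_group p)))
    (unit_conj (End_monoid (JK_group p)))"
  by (intro monoid.group_action_unit_conj monoid.monoid_End_monoid group.is_monoid group_JK_group)

definition conj_orbits :: "('a, 'b) monoid_scheme \<Rightarrow> ('a \<Rightarrow> 'a) set set"
  where "conj_orbits G =
    orbits (Aut_group G) (carrier (End_monoid G)) (unit_conj (End_monoid G))"

end

theory Submission
  imports Defs "HOL-Algebra.Generated_Groups"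
begin

text \<open>
  Let \<open>V = \<int>\<^sub>p^4\<close> be the quotient of the group by its centre \<open>W = \<int>\<^sub>p^4\<close>.  An endomorphism induces a
  linear map \<open>T\<close> of \<open>V\<close> that must be compatible with the commutator form \<open>V \<times> V \<rightarrow> W\<close> and the \<open>p\<close>-th
  power map \<open>V \<rightarrow> W\<close>; solving the resulting congruences leaves only \<open>T = 1\<close> and the maps
  \<open>T v = l(v) d\<close> with \<open>l\<close> a linear form and \<open>d = a\<^sub>1 - a\<^sub>2\<close>, the unique line on which the power map
  vanishes.  Each \<open>T\<close> lifts in \<open>p^16\<close> ways.  The lifts of \<open>T = 1\<close> are the
  automorphisms, and they form an abelian group; the lifts of \<open>T = 0\<close> are central homomorphisms, which
  commute with all automorphisms.  If \<open>l \<noteq> 0\<close>, an automorphism \<open>\<alpha>\<close> sends \<open>\<phi>\<close> to \<open>\<alpha> \<circ> \<phi>\<close>, which is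
  determined by \<open>\<alpha>(d)\<close>, an arbitrary element of the coset \<open>d W\<close>; so these orbits have length \<open>p^4\<close>.
\<close>

section \<open>A covering group on integer coordinates\<close>

text \<open>
  \<open>Cov x1 x2 y1 y2 z11 z12 z21 z22\<close> stands for
  \<open>b1^y1 b2^y2 a1^x1 a2^x2 c11^z11 c12^z12 c21^z21 c22^z22\<close> with \<open>cij = [ai, bj]\<close> central;
  moving \<open>ai^x\<close> past \<open>bj^y\<close> contributes \<open>cij^(x y)\<close>.
\<close>

datatype cover = Cov int int int int int int int int

fun cov_mult :: "cover \<Rightarrow> cover \<Rightarrow> cover" where
  "cov_mult (Cov x1 x2 y1 y2 z11 z12 z21 z22) (Cov x1' x2' y1' y2' z11' z12' z21' z22') =
    Cov (x1 + x1') (x2 + x2') (y1 + y1') (y2 + y2')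
      (z11 + z11' + x1 * y1') (z12 + z12' + x1 * y2') (z21 + z21' + x2 * y1') (z22 + z22' + x2 * y2')"

fun cov_inv :: "cover \<Rightarrow> cover" where
  "cov_inv (Cov x1 x2 y1 y2 z11 z12 z21 z22) =
    Cov (-x1) (-x2) (-y1) (-y2) (x1 * y1 - z11) (x1 * y2 - z12) (x2 * y1 - z21) (x2 * y2 - z22)"

definition CG :: "cover monoid" where
  "CG = \<lparr>carrier = UNIV, mult = cov_mult, one = Cov 0 0 0 0 0 0 0 0\<rparr>"

lemma CG_simps [simp]: "carrier CG = UNIV" "mult CG = cov_mult" "\<one>\<^bsub>CG\<^esub> = Cov 0 0 0 0 0 0 0 0"
  by (simp_all add: CG_def)

lemma cov_mult_inv [simp]: "cov_mult (cov_inv n) n = Cov 0 0 0 0 0 0 0 0"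
  by (cases n) simp

lemma group_CG: "group CG"
proof (rule groupI)
  fix x y z :: cover
  show "x \<otimes>\<^bsub>CG\<^esub> y \<otimes>\<^bsub>CG\<^esub> z = x \<otimes>\<^bsub>CG\<^esub> (y \<otimes>\<^bsub>CG\<^esub> z)"
    by (cases x; cases y; cases z) (simp add: algebra_simps)
  show "\<one>\<^bsub>CG\<^esub> \<otimes>\<^bsub>CG\<^esub> x = x" by (cases x) simp
  show "\<exists>y\<in>carrier CG. y \<otimes>\<^bsub>CG\<^esub> x = \<one>\<^bsub>CG\<^esub>"
    by (intro bexI[of _ "cov_inv x"]) simp_all
qed simp_all

lemma inv_CG [simp]: "inv\<^bsub>CG\<^esub> n = cov_inv n"
  by (intro group.inv_equality[OF group_CG]) simp_all

text \<open>Each new factor moves its \<open>b\<close>-part past the \<open>a\<close>-parts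
  collected so far; the contributions 0 + 1 + ... + (n - 1) add up to
  \<open>n choose 2\<close>.\<close>

lemma nat_pow_CG:
  "Cov x1 x2 y1 y2 z11 z12 z21 z22 [^]\<^bsub>CG\<^esub> (n::nat) =
    Cov (int n * x1) (int n * x2) (int n * y1) (int n * y2)
      (int n * z11 + int (n choose 2) * (x1 * y1)) (int n * z12 + int (n choose 2) * (x1 * y2))
      (int n * z21 + int (n choose 2) * (x2 * y1)) (int n * z22 + int (n choose 2) * (x2 * y2))"
proof (induction n)
  case (Suc n)
  have "Suc n choose 2 = (n choose 2) + n" by (simp add: numeral_2_eq_2)
  then show ?case using Suc by (simp add: algebra_simps)
qed simp

text \<open>The hypotheses remove the binomial terms, so the formula extends to negative exponents.
  Powers of single generators and of central elements have this shape.\<close>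

lemma int_pow_CG:
  assumes "x1 * y1 = 0" "x1 * y2 = 0" "x2 * y1 = 0" "x2 * y2 = 0"
  shows "Cov x1 x2 y1 y2 z11 z12 z21 z22 [^]\<^bsub>CG\<^esub> (i::int) =
    Cov (i * x1) (i * x2) (i * y1) (i * y2) (i * z11) (i * z12) (i * z21) (i * z22)"
  by (cases i rule: int_cases2)
    (use assms in \<open>auto simp: group.int_pow_neg_int[OF group_CG] int_pow_int nat_pow_CG mult.assoc\<close>)

text \<open>
  The \<open>p\<close>-th powers of \<open>a1, a2, b1, b2\<close> are \<open>c11, c11, c21 c22, c22\<close>, which produces the carries.
\<close>

fun canon :: "nat \<Rightarrow> cover \<Rightarrow> cover" where
  "canon p (Cov x1 x2 y1 y2 z11 z12 z21 z22) =
    Cov (x1 mod int p) (x2 mod int p) (y1 mod int p) (y2 mod int p)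
      ((z11 + x1 div int p + x2 div int p) mod int p)
      (z12 mod int p)
      ((z21 + y1 div int p) mod int p)
      ((z22 + y1 div int p + y2 div int p) mod int p)"

lemma mod_eq_decompose:
  fixes a b q :: int
  assumes "a mod q = b mod q"
  shows "a = b + q * (a div q - b div q)"
  using assms mult_div_mod_eq[of q a] mult_div_mod_eq[of q b]
  by (simp only: right_diff_distrib)

text \<open>The integers \<open>k1\<close>, \<open>k2\<close>, \<open>l1\<close>, \<open>l2\<close>
  count, with sign, the \<open>p\<close>-th powers of generators that become central elements when
  one tuple is changed into the other. This form avoids \<open>div\<close> and \<open>mod\<close>,
  so later congruences are plain ideal arithmetic.\<close>

lemma canon_eq_iff:
  assumes "p > 0"
  shows "canon p (Cov x1 x2 y1 y2 z11 z12 z21 z22) = canon p (Cov x1' x2' y1' y2' z11' z12' z21' z22') \<longleftrightarrow>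
    (\<exists>k1 k2 l1 l2. x1 = x1' + int p * k1 \<and> x2 = x2' + int p * k2 \<and>
      y1 = y1' + int p * l1 \<and> y2 = y2' + int p * l2 \<and>
      int p dvd z11 - z11' + k1 + k2 \<and> int p dvd z12 - z12' \<and>
      int p dvd z21 - z21' + l1 \<and> int p dvd z22 - z22' + l1 + l2)" (is "?L = ?R")
proof
  assume L: ?L
  show ?R
  proof (intro exI conjI)
    show "x1 = x1' + int p * (x1 div int p - x1' div int p)"
      "x2 = x2' + int p * (x2 div int p - x2' div int p)"
      "y1 = y1' + int p * (y1 div int p - y1' div int p)"
      "y2 = y2' + int p * (y2 div int p - y2' div int p)"
      using L by (intro mod_eq_decompose; simp)+
    have "int p dvd (z11 + x1 div int p + x2 div int p) - (z11' + x1' div int p + x2' div int p)"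
      "int p dvd (z21 + y1 div int p) - (z21' + y1' div int p)"
      "int p dvd (z22 + y1 div int p + y2 div int p) - (z22' + y1' div int p + y2' div int p)"
      using L by (simp_all only: canon.simps cover.inject mod_eq_dvd_iff)
    then show "int p dvd z11 - z11' + (x1 div int p - x1' div int p) + (x2 div int p - x2' div int p)"
      "int p dvd z21 - z21' + (y1 div int p - y1' div int p)"
      "int p dvd z22 - z22' + (y1 div int p - y1' div int p) + (y2 div int p - y2' div int p)"
      by (simp_all add: algebra_simps)
    show "int p dvd z12 - z12'"
      using L by (simp only: canon.simps cover.inject mod_eq_dvd_iff)
  qed
next
  assume ?R
  then obtain k1 k2 l1 l2 where e: "x1 = x1' + int p * k1" "x2 = x2' + int p * k2"
      "y1 = y1' + int p * l1" "y2 = y2' + int p * l2"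
    and d: "int p dvd z11 - z11' + k1 + k2" "int p dvd z12 - z12'"
      "int p dvd z21 - z21' + l1" "int p dvd z22 - z22' + l1 + l2"
    by blast
  have "x1 div int p = x1' div int p + k1" "x2 div int p = x2' div int p + k2"
    "y1 div int p = y1' div int p + l1" "y2 div int p = y2' div int p + l2"
    using assms by (simp_all add: e)
  moreover have "int p dvd (z11 + (x1' div int p + k1) + (x2' div int p + k2)) - (z11' + x1' div int p + x2' div int p)"
      "int p dvd (z21 + (y1' div int p + l1)) - (z21' + y1' div int p)"
      "int p dvd (z22 + (y1' div int p + l1) + (y2' div int p + l2)) - (z22' + y1' div int p + y2' div int p)"
    using d by (simp_all add: algebra_simps)
  moreover have "x1 mod int p = x1' mod int p" "x2 mod int p = x2' mod int p"
    "y1 mod int p = y1' mod int p" "y2 mod int p = y2' mod int p"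
    by (simp_all add: e)
  ultimately show ?L using d(2)
    by (simp only: canon.simps cover.inject mod_eq_dvd_iff simp_thms)
qed

text \<open>Multiples of \<open>p\<close> in the vector coordinates change the products
  \<open>x * y'\<close> by multiples of \<open>p\<close> only, and the carries of a product are the
  sums of the carries of its factors.\<close>

lemma canon_mult_cong:
  assumes "p > 0" "canon p m = canon p m'" "canon p n = canon p n'"
  shows "canon p (cov_mult m n) = canon p (cov_mult m' n')"
proof -
  obtain x1 x2 y1 y2 z11 z12 z21 z22 where m: "m = Cov x1 x2 y1 y2 z11 z12 z21 z22" by (cases m)
  obtain x1' x2' y1' y2' z11' z12' z21' z22' where m': "m' = Cov x1' x2' y1' y2' z11' z12' z21' z22'"
    by (cases m')
  obtain u1 u2 v1 v2 w11 w12 w21 w22 where n: "n = Cov u1 u2 v1 v2 w11 w12 w21 w22" by (cases n)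
  obtain u1' u2' v1' v2' w11' w12' w21' w22' where n': "n' = Cov u1' u2' v1' v2' w11' w12' w21' w22'"
    by (cases n')
  from assms(2) obtain k1 k2 l1 l2 where e: "x1 = x1' + int p * k1" "x2 = x2' + int p * k2"
      "y1 = y1' + int p * l1" "y2 = y2' + int p * l2"
    and d: "int p dvd z11 - z11' + k1 + k2" "int p dvd z12 - z12'"
      "int p dvd z21 - z21' + l1" "int p dvd z22 - z22' + l1 + l2"
    unfolding m m' canon_eq_iff[OF assms(1)] by blast
  from assms(3) obtain k1' k2' l1' l2' where e': "u1 = u1' + int p * k1'" "u2 = u2' + int p * k2'"
      "v1 = v1' + int p * l1'" "v2 = v2' + int p * l2'"
    and d': "int p dvd w11 - w11' + k1' + k2'" "int p dvd w12 - w12'"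
      "int p dvd w21 - w21' + l1'" "int p dvd w22 - w22' + l1' + l2'"
    unfolding n n' canon_eq_iff[OF assms(1)] by blast
  show ?thesis
    unfolding m m' n n' cov_mult.simps canon_eq_iff[OF assms(1)] e e'
    apply (rule exI[of _ "k1 + k1'"], rule exI[of _ "k2 + k2'"], rule exI[of _ "l1 + l1'"],
        rule exI[of _ "l2 + l2'"])
    apply (intro conjI)
    subgoal by algebra
    subgoal by algebra
    subgoal by algebra
    subgoal by algebra
    subgoal using d(1) d'(1) by algebra
    subgoal using d(2) d'(2) by algebra
    subgoal using d(3) d'(3) by algebra
    subgoal using d(4) d'(4) by algebra
    done
qed

section \<open>Normal forms in groups of class two\<close>

context group
begin

text \<open>Conjugation by \<open>g\<close> is a homomorphism that takes \<open>a'\<close> to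
  \<open>a\<close>, which settles positive and negative exponents at once.\<close>

lemma int_pow_intertwine:
  assumes [simp]: "a \<in> carrier G" "a' \<in> carrier G" "g \<in> carrier G"
    and eq: "a \<otimes> g = g \<otimes> a'"
  shows "a [^] (i::int) \<otimes> g = g \<otimes> a' [^] i"
proof -
  have a: "a = g \<otimes> a' \<otimes> inv g"
    using eq by (simp add: inv_solve_right)
  have "(\<lambda>x. g \<otimes> x \<otimes> inv g) \<in> hom G G"
  proof (rule homI)
    fix x y assume [simp]: "x \<in> carrier G" "y \<in> carrier G"
    have "inv g \<otimes> (g \<otimes> (y \<otimes> inv g)) = y \<otimes> inv g"
      by (simp flip: m_assoc)
    then show "g \<otimes> (x \<otimes> y) \<otimes> inv g = g \<otimes> x \<otimes> inv g \<otimes> (g \<otimes> y \<otimes> inv g)"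
      by (simp add: m_assoc)
  qed simp
  from hom_int_pow[OF this, of a' i] have "a [^] i = g \<otimes> a' [^] i \<otimes> inv g"
    using is_group by (simp add: a)
  then show ?thesis by (simp add: m_assoc)
qed

definition central :: "'a \<Rightarrow> bool" where
  "central z \<longleftrightarrow> z \<in> carrier G \<and> (\<forall>g\<in>carrier G. z \<otimes> g = g \<otimes> z)"

lemma central_closed [simp, intro]: "central z \<Longrightarrow> z \<in> carrier G"
  by (simp add: central_def)

lemma central_commute: "central z \<Longrightarrow> g \<in> carrier G \<Longrightarrow> z \<otimes> g = g \<otimes> z"
  unfolding central_def by blast

lemma central_one [simp]: "central \<one>"
  unfolding central_def by simp

lemma centralI:
  assumes "z \<in> carrier G" "\<And>g. g \<in> carrier G \<Longrightarrow> z \<otimes> g = g \<otimes> z"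
  shows "central z"
  using assms unfolding central_def by blast

lemma central_mult [simp, intro]:
  assumes "central y" "central z"
  shows "central (y \<otimes> z)"
proof (rule centralI)
  fix g assume [simp]: "g \<in> carrier G"
  have "y \<otimes> z \<otimes> g = y \<otimes> (g \<otimes> z)"
    using assms by (simp add: m_assoc central_commute[of z g])
  also have "\<dots> = y \<otimes> g \<otimes> z"
    using assms by (simp add: m_assoc)
  also have "y \<otimes> g = g \<otimes> y"
    using assms by (simp add: central_commute[of y g])
  finally show "y \<otimes> z \<otimes> g = g \<otimes> (y \<otimes> z)"
    using assms by (simp add: m_assoc)
qed (use assms in simp)

lemma central_int_pow [simp, intro]:
  assumes "central z"
  shows "central (z [^] (i::int))"
proof (rule centralI)
  fix g assume "g \<in> carrier G"
  then show "z [^] i \<otimes> g = g \<otimes> z [^] i"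
    using assms by (intro int_pow_intertwine) (auto intro: central_commute)
qed (use assms in simp)

lemma mult_mult_swap:
  assumes "x \<in> carrier G" "y \<in> carrier G" "u \<in> carrier G" "v \<in> carrier G" "y \<otimes> u = u \<otimes> y"
  shows "(x \<otimes> y) \<otimes> (u \<otimes> v) = (x \<otimes> u) \<otimes> (y \<otimes> v)"
proof -
  have "y \<otimes> (u \<otimes> v) = u \<otimes> (y \<otimes> v)"
    using assms by (metis m_assoc)
  then show ?thesis using assms by (simp add: m_assoc)
qed

text \<open>This and the next lemma are the bilinearity of commutators in class two, phrased with
  products so that no inverses have to be moved.\<close>

lemma commute_up_to_central_mult_right:
  assumes [simp]: "a \<in> carrier G" "b \<in> carrier G" "b' \<in> carrier G" "central k" "central k'"
    and eq: "a \<otimes> b = b \<otimes> a \<otimes> k" "a \<otimes> b' = b' \<otimes> a \<otimes> k'"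
  shows "a \<otimes> (b \<otimes> b') = (b \<otimes> b') \<otimes> a \<otimes> (k \<otimes> k')"
proof -
  have "a \<otimes> (b \<otimes> b') = b \<otimes> a \<otimes> (k \<otimes> b')"
    by (simp add: eq(1) flip: m_assoc)
  also have "k \<otimes> b' = b' \<otimes> k" by (intro central_commute) simp_all
  also have "b \<otimes> a \<otimes> (b' \<otimes> k) = b \<otimes> (a \<otimes> b') \<otimes> k" by (simp add: m_assoc)
  also have "\<dots> = b \<otimes> b' \<otimes> a \<otimes> (k' \<otimes> k)" by (simp add: eq(2) m_assoc)
  also have "k' \<otimes> k = k \<otimes> k'" by (intro central_commute) simp_all
  finally show ?thesis .
qed

lemma commute_up_to_central_mult_left:
  assumes [simp]: "a \<in> carrier G" "b \<in> carrier G" "a' \<in> carrier G" "central k" "central k'"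
    and eq: "a \<otimes> b = b \<otimes> a \<otimes> k" "a' \<otimes> b = b \<otimes> a' \<otimes> k'"
  shows "(a \<otimes> a') \<otimes> b = b \<otimes> (a \<otimes> a') \<otimes> (k \<otimes> k')"
proof -
  have "(a \<otimes> a') \<otimes> b = (a \<otimes> b) \<otimes> a' \<otimes> k'"
    by (simp add: eq(2) m_assoc)
  also have "\<dots> = b \<otimes> a \<otimes> (k \<otimes> a') \<otimes> k'" by (subst eq(1)) (simp add: m_assoc)
  also have "k \<otimes> a' = a' \<otimes> k" by (intro central_commute) simp_all
  finally show ?thesis by (simp add: m_assoc)
qed

text \<open>Intertwining is used twice: moving \<open>a\<close> past \<open>b [^] y\<close> turns it
  into \<open>a \<otimes> c [^] y\<close>, and then the power \<open>x\<close> is taken.\<close>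

lemma int_pow_commute_up_to_central:
  assumes [simp]: "a \<in> carrier G" "b \<in> carrier G" "central c"
    and eq: "a \<otimes> b = b \<otimes> a \<otimes> c"
  shows "a [^] (x::int) \<otimes> b [^] (y::int) = b [^] y \<otimes> a [^] x \<otimes> c [^] (x * y)"
proof -
  have bc: "(b \<otimes> c) \<otimes> a = a \<otimes> b"
    using central_commute[of c a] by (simp add: eq m_assoc)
  have "(b \<otimes> c) [^] y = b [^] y \<otimes> c [^] y"
    by (intro int_pow_mult_distrib central_commute[symmetric]) simp_all
  then have "a \<otimes> b [^] y = b [^] y \<otimes> (c [^] y \<otimes> a)"
    using int_pow_intertwine[OF _ _ _ bc, of y] by (simp add: m_assoc)
  also have "c [^] y \<otimes> a = a \<otimes> c [^] y"
    by (intro central_commute) simp_all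
  finally have "a [^] x \<otimes> b [^] y = b [^] y \<otimes> (a \<otimes> c [^] y) [^] x"
    by (intro int_pow_intertwine) simp_all
  also have "(a \<otimes> c [^] y) [^] x = a [^] x \<otimes> (c [^] y) [^] x"
    by (intro int_pow_mult_distrib central_commute[symmetric]) simp_all
  finally show ?thesis by (simp add: int_pow_pow mult.commute m_assoc)
qed

end

section \<open>Evaluation of integer coordinates under the commutation relations\<close>

locale jk_elements = group G for G (structure) +
  fixes a1 a2 b1 b2 c11 c12 c21 c22 :: 'a
  assumes closed [simp]: "a1 \<in> carrier G" "a2 \<in> carrier G" "b1 \<in> carrier G" "b2 \<in> carrier G"
    and c_central [simp]: "central c11" "central c12" "central c21" "central c22"
    and aa: "a1 \<otimes> a2 = a2 \<otimes> a1"
    and bb: "b1 \<otimes> b2 = b2 \<otimes> b1"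
    and ab: "a1 \<otimes> b1 = b1 \<otimes> a1 \<otimes> c11" "a1 \<otimes> b2 = b2 \<otimes> a1 \<otimes> c12"
      "a2 \<otimes> b1 = b1 \<otimes> a2 \<otimes> c21" "a2 \<otimes> b2 = b2 \<otimes> a2 \<otimes> c22"
begin

definition cpart :: "int \<Rightarrow> int \<Rightarrow> int \<Rightarrow> int \<Rightarrow> 'a" where
  "cpart z11 z12 z21 z22 = (c11 [^] z11 \<otimes> c12 [^] z12) \<otimes> (c21 [^] z21 \<otimes> c22 [^] z22)"

definition apart :: "int \<Rightarrow> int \<Rightarrow> 'a" where "apart x1 x2 = a1 [^] x1 \<otimes> a2 [^] x2"

definition bpart :: "int \<Rightarrow> int \<Rightarrow> 'a" where "bpart y1 y2 = b1 [^] y1 \<otimes> b2 [^] y2"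

fun val :: "cover \<Rightarrow> 'a" where
  "val (Cov x1 x2 y1 y2 z11 z12 z21 z22) = bpart y1 y2 \<otimes> apart x1 x2 \<otimes> cpart z11 z12 z21 z22"

lemma cpart_central [simp]: "central (cpart z11 z12 z21 z22)"
  by (simp add: cpart_def)

lemma apart_closed [simp]: "apart x1 x2 \<in> carrier G"
  by (simp add: apart_def)

lemma bpart_closed [simp]: "bpart x1 x2 \<in> carrier G"
  by (simp add: bpart_def)

lemma val_closed [simp]: "val n \<in> carrier G"
  by (cases n) simp

lemma int_pow_commute:
  assumes "a \<in> carrier G" "b \<in> carrier G" "a \<otimes> b = b \<otimes> a"
  shows "a [^] (x::int) \<otimes> b [^] (y::int) = b [^] y \<otimes> a [^] x"
  using int_pow_commute_up_to_central[of a b \<one> x y] assms by simp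

lemma apart_add: "apart x1 x2 \<otimes> apart x1' x2' = apart (x1 + x1') (x2 + x2')"
  unfolding apart_def
  by (subst mult_mult_swap) (simp_all add: int_pow_mult int_pow_commute[OF _ _ aa])

lemma bpart_add: "bpart x1 x2 \<otimes> bpart x1' x2' = bpart (x1 + x1') (x2 + x2')"
  unfolding bpart_def
  by (subst mult_mult_swap) (simp_all add: int_pow_mult int_pow_commute[OF _ _ bb])

lemma cpart_add:
  "cpart z11 z12 z21 z22 \<otimes> cpart w11 w12 w21 w22 = cpart (z11 + w11) (z12 + w12) (z21 + w21) (z22 + w22)"
proof -
  have "(c11 [^] z11 \<otimes> c12 [^] z12) \<otimes> (c11 [^] w11 \<otimes> c12 [^] w12) =
      c11 [^] (z11 + w11) \<otimes> c12 [^] (z12 + w12)"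
    by (subst mult_mult_swap) (auto simp: int_pow_mult intro: central_commute)
  moreover have "(c21 [^] z21 \<otimes> c22 [^] z22) \<otimes> (c21 [^] w21 \<otimes> c22 [^] w22) =
      c21 [^] (z21 + w21) \<otimes> c22 [^] (z22 + w22)"
    by (subst mult_mult_swap) (auto simp: int_pow_mult intro: central_commute)
  ultimately show ?thesis
    unfolding cpart_def by (subst mult_mult_swap) (auto intro: central_commute)
qed

lemma apart_bpart:
  "apart x1 x2 \<otimes> bpart y1 y2 = bpart y1 y2 \<otimes> apart x1 x2 \<otimes> cpart (x1 * y1) (x1 * y2) (x2 * y1) (x2 * y2)"
  unfolding apart_def bpart_def cpart_def
  by (intro commute_up_to_central_mult_left commute_up_to_central_mult_right
      int_pow_commute_up_to_central ab) simp_all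

text \<open>The collection process: the central part of \<open>m\<close> moves to the right, then
  its \<open>a\<close>-part passes the \<open>b\<close>-part of \<open>n\<close> and leaves
  \<open>?K\<close> behind. After that the three kinds of factors multiply separately.\<close>

lemma val_mult: "val m \<otimes> val n = val (cov_mult m n)"
proof -
  obtain x1 x2 y1 y2 z11 z12 z21 z22 where m: "m = Cov x1 x2 y1 y2 z11 z12 z21 z22" by (cases m)
  obtain u1 u2 v1 v2 w11 w12 w21 w22 where n: "n = Cov u1 u2 v1 v2 w11 w12 w21 w22" by (cases n)
  let ?A = "apart x1 x2" and ?B = "bpart y1 y2" and ?C = "cpart z11 z12 z21 z22"
  let ?A' = "apart u1 u2" and ?B' = "bpart v1 v2" and ?C' = "cpart w11 w12 w21 w22"
  let ?K = "cpart (x1 * v1) (x1 * v2) (x2 * v1) (x2 * v2)"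
  have "val m \<otimes> val n = ?B \<otimes> ?A \<otimes> (?C \<otimes> (?B' \<otimes> ?A')) \<otimes> ?C'"
    by (simp add: m n m_assoc)
  also have "?C \<otimes> (?B' \<otimes> ?A') = (?B' \<otimes> ?A') \<otimes> ?C"
    by (intro central_commute) simp_all
  also have "?B \<otimes> ?A \<otimes> ((?B' \<otimes> ?A') \<otimes> ?C) \<otimes> ?C' = ?B \<otimes> (?A \<otimes> ?B') \<otimes> (?A' \<otimes> (?C \<otimes> ?C'))"
    by (simp add: m_assoc)
  also have "\<dots> = (?B \<otimes> ?B') \<otimes> ?A \<otimes> (?K \<otimes> ?A') \<otimes> (?C \<otimes> ?C')"
    by (simp add: apart_bpart m_assoc)
  also have "?K \<otimes> ?A' = ?A' \<otimes> ?K"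
    by (intro central_commute) simp_all
  also have "(?B \<otimes> ?B') \<otimes> ?A \<otimes> (?A' \<otimes> ?K) \<otimes> (?C \<otimes> ?C') =
      (?B \<otimes> ?B') \<otimes> (?A \<otimes> ?A') \<otimes> (?K \<otimes> (?C \<otimes> ?C'))"
    by (simp add: m_assoc)
  also have "\<dots> = val (cov_mult m n)"
    by (simp add: apart_add bpart_add cpart_add m n algebra_simps)
  finally show ?thesis .
qed

lemma val_hom: "val \<in> hom CG G"
  by (rule homI) (simp_all add: val_mult)

lemma val_generators:
  "val (Cov 1 0 0 0 0 0 0 0) = a1" "val (Cov 0 1 0 0 0 0 0 0) = a2"
  "val (Cov 0 0 1 0 0 0 0 0) = b1" "val (Cov 0 0 0 1 0 0 0 0) = b2"
  by (simp_all add: apart_def bpart_def cpart_def)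

end

section \<open>Power relations and reduction of the coordinates modulo \<open>p\<close>\<close>

locale jk_relations = jk_elements +
  fixes p :: nat
  assumes p_pos: "p > 0"
    and pows: "a1 [^] p = c11" "a2 [^] p = c11" "b1 [^] p = c21 \<otimes> c22" "b2 [^] p = c22"
begin

lemma int_pows: "a1 [^] int p = c11" "a2 [^] int p = c11" "b1 [^] int p = c21 \<otimes> c22" "b2 [^] int p = c22"
  using pows by (simp_all add: int_pow_int)

text \<open>The \<open>p\<close>-th powers of \<open>a1\<close>, \<open>a2\<close> are central, so their commutators with \<open>b1\<close>, \<open>b2\<close> vanish.\<close>

lemma c_pow: "c11 [^] int p = \<one>" "c12 [^] int p = \<one>" "c21 [^] int p = \<one>" "c22 [^] int p = \<one>"
proof -
  have *: "c [^] int p = \<one>"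
    if [simp]: "a \<in> carrier G" "b \<in> carrier G" "central c" and "central (a [^] int p)"
      and "a \<otimes> b = b \<otimes> a \<otimes> c" for a b c
    using int_pow_commute_up_to_central[OF that(1-3,5), of "int p" 1]
      central_commute[OF that(4), of b] by simp
  show "c11 [^] int p = \<one>" "c12 [^] int p = \<one>" "c21 [^] int p = \<one>" "c22 [^] int p = \<one>"
    by (rule *[OF _ _ _ _ ab(1)] *[OF _ _ _ _ ab(2)] *[OF _ _ _ _ ab(3)] *[OF _ _ _ _ ab(4)];
        simp add: int_pows)+
qed

lemma cpart_mod:
  "cpart (z11 mod int p) (z12 mod int p) (z21 mod int p) (z22 mod int p) = cpart z11 z12 z21 z22"
proof -
  have "c [^] (z mod int p) = c [^] z" if "c [^] int p = \<one>" "c \<in> carrier G" for c and z :: int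
  proof -
    have "c [^] z = c [^] (int p * (z div int p) + z mod int p)" by simp
    also have "\<dots> = c [^] (z mod int p)"
      using that by (simp only: int_pow_mult flip: int_pow_pow) simp
    finally show ?thesis by simp
  qed
  then show ?thesis by (simp add: cpart_def c_pow)
qed

text \<open>A vector of multiples of \<open>p\<close> evaluates to a product of \<open>p\<close>-th
  powers of generators, and these are central: this is the origin of the carries in
  \<open>canon\<close>.\<close>

lemma val_p_multiple:
  "val (Cov (int p * k1) (int p * k2) (int p * l1) (int p * l2) 0 0 0 0) = cpart (k1 + k2) 0 l1 (l1 + l2)"
proof -
  have "b1 [^] (int p * l1) = (c21 \<otimes> c22) [^] l1" "b2 [^] (int p * l2) = c22 [^] l2"
    "a1 [^] (int p * k1) = c11 [^] k1" "a2 [^] (int p * k2) = c11 [^] k2"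
    by (simp_all add: int_pows flip: int_pow_pow)
  moreover have "(c21 \<otimes> c22) [^] l1 = c21 [^] l1 \<otimes> c22 [^] l1"
    by (intro int_pow_mult_distrib central_commute[symmetric]) simp_all
  moreover have "c21 [^] i = cpart 0 0 i 0" "c22 [^] i = cpart 0 0 0 i" "c11 [^] i = cpart i 0 0 0" for i :: int
    by (simp_all add: cpart_def)
  ultimately have "val (Cov (int p * k1) (int p * k2) (int p * l1) (int p * l2) 0 0 0 0) =
    (cpart 0 0 l1 0 \<otimes> cpart 0 0 0 l1 \<otimes> cpart 0 0 0 l2) \<otimes> (cpart k1 0 0 0 \<otimes> cpart k2 0 0 0) \<otimes> cpart 0 0 0 0"
    by (simp only: val.simps apart_def bpart_def)
  then show ?thesis by (simp add: cpart_add)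
qed

lemma val_canon: "val (canon p n) = val n"
proof -
  obtain x1 x2 y1 y2 z11 z12 z21 z22 where n: "n = Cov x1 x2 y1 y2 z11 z12 z21 z22" by (cases n)
  let ?m = "\<lambda>z. z mod int p" and ?d = "\<lambda>z. z div int p"
  \<comment> \<open>Each vector coordinate is split into residue and multiple of \<open>p\<close>.
    The subtracted terms cancel the commutators created by this product; being multiples of
    \<open>p\<close>, they disappear again when the central part is reduced.\<close>
  have "n = cov_mult
      (Cov (?m x1) (?m x2) (?m y1) (?m y2) (z11 - ?m x1 * (int p * ?d y1)) (z12 - ?m x1 * (int p * ?d y2))
        (z21 - ?m x2 * (int p * ?d y1)) (z22 - ?m x2 * (int p * ?d y2)))
      (Cov (int p * ?d x1) (int p * ?d x2) (int p * ?d y1) (int p * ?d y2) 0 0 0 0)"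
    by (simp add: n)
  then have "val n = val
      (Cov (?m x1) (?m x2) (?m y1) (?m y2) (z11 - ?m x1 * (int p * ?d y1)) (z12 - ?m x1 * (int p * ?d y2))
        (z21 - ?m x2 * (int p * ?d y1)) (z22 - ?m x2 * (int p * ?d y2))) \<otimes>
      val (Cov (int p * ?d x1) (int p * ?d x2) (int p * ?d y1) (int p * ?d y2) 0 0 0 0)"
    by (simp only: val_mult)
  also have "\<dots> = bpart (?m y1) (?m y2) \<otimes> apart (?m x1) (?m x2) \<otimes>
      cpart (z11 - ?m x1 * (int p * ?d y1) + (?d x1 + ?d x2)) (z12 - ?m x1 * (int p * ?d y2))
        (z21 - ?m x2 * (int p * ?d y1) + ?d y1) (z22 - ?m x2 * (int p * ?d y2) + (?d y1 + ?d y2))"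
    by (simp only: val_p_multiple) (simp add: m_assoc cpart_add)
  also have "cpart (z11 - ?m x1 * (int p * ?d y1) + (?d x1 + ?d x2)) (z12 - ?m x1 * (int p * ?d y2))
        (z21 - ?m x2 * (int p * ?d y1) + ?d y1) (z22 - ?m x2 * (int p * ?d y2) + (?d y1 + ?d y2))
      = cpart (z11 + ?d x1 + ?d x2) z12 (z21 + ?d y1) (z22 + ?d y1 + ?d y2)"
  proof -
    have e: "?m (z - a * (int p * b) + c) = ?m (z + c)" for z a b c
      by (simp add: mod_eq_dvd_iff)
    have e': "?m (z - a * (int p * b)) = ?m z" for z a b
      by (simp add: mod_eq_dvd_iff)
    show ?thesis
      by (subst (1 2) cpart_mod[symmetric]) (simp only: e e' add.assoc)
  qed
  also have "\<dots> = cpart (?m (z11 + ?d x1 + ?d x2)) (?m z12) (?m (z21 + ?d y1)) (?m (z22 + ?d y1 + ?d y2))"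
    by (simp only: cpart_mod)
  finally show ?thesis by (simp add: n)
qed

end

section \<open>Normal forms in the presented group\<close>

context group
begin

lemma word_eval_gen [simp]:
  assumes "f \<in> UNIV \<rightarrow> carrier G"
  shows "word_eval G f (gen x) = f x"
  using assms by (auto simp: gen_def word_eval_def Pi_iff)

lemma word_eval_word_inv [simp]:
  assumes f: "f \<in> UNIV \<rightarrow> carrier G"
  shows "word_eval G f (word_inv w) = inv (word_eval G f w)"
proof (induction w)
  case (Cons a w)
  obtain x s where a: "a = (x, s)" by (cases a)
  have [simp]: "f y \<in> carrier G" for y using f by auto
  have "word_inv (a # w) = word_inv w @ [(x, \<not> s)]"
    by (simp add: word_inv_def a)
  then have "word_eval G f (word_inv (a # w)) = inv (word_eval G f w) \<otimes> word_eval G f [(x, \<not> s)]"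
    by (simp add: word_eval_append[OF f] Cons.IH)
  also have "word_eval G f [(x, \<not> s)] = inv (word_eval G f [(x, s)])"
    by (simp add: word_eval_def)
  also have "inv (word_eval G f w) \<otimes> inv (word_eval G f [(x, s)]) = inv (word_eval G f ([(x, s)] @ w))"
    unfolding word_eval_append[OF f] by (simp add: inv_mult_group word_eval_closed[OF f])
  finally show ?case by (simp add: a)
qed (simp add: word_inv_def word_eval_def)

lemma word_eval_word_comm [simp]:
  assumes "f \<in> UNIV \<rightarrow> carrier G"
  shows "word_eval G f (word_comm u v) =
    inv (word_eval G f u) \<otimes> inv (word_eval G f v) \<otimes> word_eval G f u \<otimes> word_eval G f v"
  using assms by (simp add: word_comm_def word_eval_append word_eval_closed m_assoc)

lemma word_eval_word_pow [simp]:
  assumes "f \<in> UNIV \<rightarrow> carrier G"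
  shows "word_eval G f (word_pow w n) = word_eval G f w [^] n"
proof (induction n)
  case (Suc n)
  have "word_eval G f (word_pow w (Suc n)) = word_eval G f w \<otimes> word_eval G f w [^] n"
    using Suc assms by (simp add: word_pow_def word_eval_append)
  then show ?case using nat_pow_Suc2[OF word_eval_closed[OF assms]] by metis
qed (simp add: word_pow_def word_eval_def)

lemma word_eval_hom:
  assumes f: "f \<in> UNIV \<rightarrow> carrier G" and H: "group H" and h: "h \<in> hom G H"
  shows "h (word_eval G f w) = word_eval H (\<lambda>x. h (f x)) w"
proof -
  interpret h: group_hom G H h
    using H h by (simp add: group_hom_def group_hom_axioms_def is_group)
  have [simp]: "f x \<in> carrier G" for x using f by auto
  show ?thesis
  proof (induction w)
    case (Cons a w)
    have "word_eval G f w \<in> carrier G" by (rule word_eval_closed[OF f])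
    with Cons show ?case by (cases a) (auto simp: word_eval_def)
  qed (simp add: word_eval_def)
qed

end

text \<open>Through this, the evaluation rules for inverses, powers and commutators of words become
  rules for the classes of words.\<close>

lemma word_class_eq_word_eval:
  "word_class R w = word_eval (presented_group R) (\<lambda>x. word_class R (gen x)) w"
proof -
  interpret group "presented_group R" by (rule group_presented_group)
  show ?thesis
  proof (induction w)
    case (Cons a w)
    obtain x s where a: "a = (x, s)" by (cases a)
    have "word_class R [(x, False)] = inv\<^bsub>presented_group R\<^esub> word_class R (gen x)"
      using word_eq.cancel[of R x False]
      by (intro inv_equality[symmetric])
        (auto simp: presented_group_simps presented_group_mult word_class_eq_iff gen_def)
    moreover have "word_class R (a # w) = word_class R [a] \<otimes>\<^bsub>presented_group R\<^esub> word_class R w"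
      by (simp add: presented_group_mult)
    ultimately show ?case
      using Cons.IH a by (cases s) (simp_all add: word_eval_def gen_def)
  qed (simp add: word_eval_def presented_group_simps)
qed

fun std :: "jk_gen \<Rightarrow> cover" where
  "std A1 = Cov 1 0 0 0 0 0 0 0" | "std A2 = Cov 0 1 0 0 0 0 0 0"
| "std B1 = Cov 0 0 1 0 0 0 0 0" | "std B2 = Cov 0 0 0 1 0 0 0 0"

interpretation CG: group CG by (rule group_CG)

abbreviation cov_eval :: "(jk_gen \<Rightarrow> cover) \<Rightarrow> jk_gen word \<Rightarrow> cover" where
  "cov_eval \<equiv> word_eval CG"

text \<open>A commutator has zero vector coordinates, and such elements are central. Thus
  \<open>CG\<close> satisfies the class-two relations exactly, before any reduction modulo
  \<open>p\<close>.\<close>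

lemma cov_commutator_commute:
  "cov_mult (cov_mult (cov_mult (cov_mult (cov_inv m) (cov_inv n)) m) n) k =
   cov_mult k (cov_mult (cov_mult (cov_mult (cov_inv m) (cov_inv n)) m) n)"
  by (cases m; cases n; cases k) (simp add: algebra_simps)

section \<open>Identification of the presented group with the canonical coordinates\<close>

locale jk =
  fixes p :: nat
  assumes prime: "prime p"
begin

abbreviation cl where "cl \<equiv> word_class (JK_rels p)"

abbreviation G where "G \<equiv> JK_group p"

sublocale group G by (rule group_JK_group)

lemma cl_in_carrier [simp]: "cl w \<in> carrier G"
  by (simp add: JK_group_def presented_group_simps)

lemma carrier_G: "carrier G = range cl"
  by (simp add: JK_group_def presented_group_simps)

lemma cl_append: "cl (u @ v) = cl u \<otimes>\<^bsub>G\<^esub> cl v"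
  by (simp add: JK_group_def presented_group_mult)

lemma cl_gen_Pi [simp]: "(\<lambda>x. cl (gen x)) \<in> UNIV \<rightarrow> carrier G"
  by simp

lemma cl_eval: "cl w = word_eval G (\<lambda>x. cl (gen x)) w"
  unfolding JK_group_def by (rule word_class_eq_word_eval)

lemma cl_comm: "cl (word_comm u v) = inv\<^bsub>G\<^esub> cl u \<otimes>\<^bsub>G\<^esub> inv\<^bsub>G\<^esub> cl v \<otimes>\<^bsub>G\<^esub> cl u \<otimes>\<^bsub>G\<^esub> cl v"
  by (subst (1 2 3 4 5) cl_eval) simp

lemma cl_pow: "cl (word_pow w n) = cl w [^]\<^bsub>G\<^esub> n"
  by (subst (1 2) cl_eval) simp

lemma cl_comm_central: "central (cl (word_comm u v))"
proof (rule centralI)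
  fix g assume "g \<in> carrier G"
  then obtain w where g: "g = cl w" by (auto simp: carrier_G)
  have "word_eq (JK_rels p) (word_comm u v @ w) (w @ word_comm u v)"
    by (rule word_eq.rel) (auto simp: JK_rels_def class2_rels_def)
  then show "cl (word_comm u v) \<otimes>\<^bsub>G\<^esub> g = g \<otimes>\<^bsub>G\<^esub> cl (word_comm u v)"
    by (simp add: g word_class_eq_iff flip: cl_append)
qed simp

lemma cl_rel: "(u, v) \<in> JK_rels p \<Longrightarrow> cl u = cl v"
  unfolding word_class_eq_iff by (rule word_eq.rel)

lemma cl_commute: "cl u \<otimes>\<^bsub>G\<^esub> cl v = cl v \<otimes>\<^bsub>G\<^esub> cl u \<otimes>\<^bsub>G\<^esub> cl (word_comm u v)"
proof -
  have "cl v \<otimes>\<^bsub>G\<^esub> cl u \<otimes>\<^bsub>G\<^esub> cl (word_comm u v) =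
      cl v \<otimes>\<^bsub>G\<^esub> (cl u \<otimes>\<^bsub>G\<^esub> inv\<^bsub>G\<^esub> cl u) \<otimes>\<^bsub>G\<^esub> inv\<^bsub>G\<^esub> cl v \<otimes>\<^bsub>G\<^esub> (cl u \<otimes>\<^bsub>G\<^esub> cl v)"
    unfolding cl_comm by (simp only: m_assoc cl_in_carrier inv_closed m_closed)
  also have "\<dots> = cl u \<otimes>\<^bsub>G\<^esub> cl v"
    by simp
  finally show ?thesis ..
qed

lemma cl_commute_trivial:
  assumes "(word_comm u v, []) \<in> JK_rels p"
  shows "cl u \<otimes>\<^bsub>G\<^esub> cl v = cl v \<otimes>\<^bsub>G\<^esub> cl u"
proof -
  have "cl (word_comm u v) = \<one>\<^bsub>G\<^esub>"
    using cl_rel[OF assms] by (simp add: JK_group_def presented_group_simps)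
  then show ?thesis by (subst cl_commute) simp
qed

sublocale jk_relations G "cl (gen A1)" "cl (gen A2)" "cl (gen B1)" "cl (gen B2)"
  "cl (word_comm (gen A1) (gen B1))" "cl (word_comm (gen A1) (gen B2))"
  "cl (word_comm (gen A2) (gen B1))" "cl (word_comm (gen A2) (gen B2))" p
proof unfold_locales
  show "p > 0" using prime by (simp add: prime_gt_0_nat)
  \<comment> \<open>The relation for \<open>B1\<close> involves the commutator of \<open>A2\<close>
    with a product; bilinearity splits it into the two commutators that the locale asks for.\<close>
  have "cl (gen B1 @ gen B2) \<otimes>\<^bsub>G\<^esub> cl (gen A2) \<otimes>\<^bsub>G\<^esub> cl (word_comm (gen A2) (gen B1 @ gen B2)) =
     cl (gen A2) \<otimes>\<^bsub>G\<^esub> (cl (gen B1) \<otimes>\<^bsub>G\<^esub> cl (gen B2))"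
    by (subst cl_commute[symmetric]) (simp add: cl_append)
  also have "\<dots> = (cl (gen B1) \<otimes>\<^bsub>G\<^esub> cl (gen B2)) \<otimes>\<^bsub>G\<^esub> cl (gen A2) \<otimes>\<^bsub>G\<^esub>
      (cl (word_comm (gen A2) (gen B1)) \<otimes>\<^bsub>G\<^esub> cl (word_comm (gen A2) (gen B2)))"
    by (intro commute_up_to_central_mult_right cl_commute cl_comm_central) simp_all
  finally have "cl (word_comm (gen A2) (gen B1 @ gen B2)) =
      cl (word_comm (gen A2) (gen B1)) \<otimes>\<^bsub>G\<^esub> cl (word_comm (gen A2) (gen B2))"
    by (simp add: cl_append)
  moreover have "cl (gen B1) [^]\<^bsub>G\<^esub> p = cl (word_comm (gen A2) (gen B1 @ gen B2))"
    unfolding cl_pow[symmetric] by (rule cl_rel) (simp add: JK_rels_def)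
  ultimately show "cl (gen B1) [^]\<^bsub>G\<^esub> p =
      cl (word_comm (gen A2) (gen B1)) \<otimes>\<^bsub>G\<^esub> cl (word_comm (gen A2) (gen B2))"
    by simp
  show "cl (gen A1) \<otimes>\<^bsub>G\<^esub> cl (gen A2) = cl (gen A2) \<otimes>\<^bsub>G\<^esub> cl (gen A1)"
    "cl (gen B1) \<otimes>\<^bsub>G\<^esub> cl (gen B2) = cl (gen B2) \<otimes>\<^bsub>G\<^esub> cl (gen B1)"
    by (rule cl_commute_trivial; simp add: JK_rels_def)+
  show "cl (gen A1) [^]\<^bsub>G\<^esub> p = cl (word_comm (gen A1) (gen B1))"
    "cl (gen A2) [^]\<^bsub>G\<^esub> p = cl (word_comm (gen A1) (gen B1))"
    "cl (gen B2) [^]\<^bsub>G\<^esub> p = cl (word_comm (gen A2) (gen B2))"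
    unfolding cl_pow[symmetric] by (rule cl_rel; simp add: JK_rels_def)+
qed (rule cl_comm_central cl_commute cl_in_carrier)+

lemma val_std: "val (std x) = cl (gen x)"
  by (cases x) (simp_all only: std.simps val_generators)

lemma cl_eq_val: "cl w = val (cov_eval std w)"
  by (subst cl_eval) (simp add: CG.word_eval_hom[OF _ group_axioms val_hom] val_std)

text \<open>An invariant of word classes: the class-two relations hold in \<open>CG\<close>, the
  others hold after \<open>canon\<close>, and \<open>canon_mult_cong\<close> covers concatenation.
  It guarantees that the presentation does not collapse the coordinates any further.\<close>

lemma canon_eval_eq:
  assumes "word_eq (JK_rels p) u v"
  shows "canon p (cov_eval std u) = canon p (cov_eval std v)"
  using assms
proof induction
  case (rel u v)
  show ?case
  proof (cases "(u, v) \<in> class2_rels")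
    case True
    then show ?thesis
      by (auto simp: class2_rels_def CG.word_eval_append cov_commutator_commute)
  next
    case False
    then have "(u, v) \<in> JK_rels p - class2_rels" using rel by simp
    moreover have "cov_eval std [] = Cov 0 0 0 0 0 0 0 0"
      by (simp add: word_eval_def)
    ultimately show ?thesis using p_pos
      by (auto simp: JK_rels_def nat_pow_CG CG.word_eval_append)
  qed
next
  case (cancel x s)
  have "cov_mult n (cov_inv n) = Cov 0 0 0 0 0 0 0 0" for n by (cases n) simp
  moreover have "cov_mult n (Cov 0 0 0 0 0 0 0 0) = n" for n by (cases n) simp
  ultimately have "cov_eval std [(x, s), (x, \<not> s)] = cov_eval std []"
    by (cases s) (simp_all add: word_eval_def)
  then show ?case by simp
next
  case (append u u' v v')
  show ?case
    using canon_mult_cong[OF p_pos append.IH] by (simp add: CG.word_eval_append)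
qed simp_all

lemma subgroup_range_eval: "subgroup (range (cov_eval std)) CG"
proof
  show "\<one>\<^bsub>CG\<^esub> \<in> range (cov_eval std)"
    by (rule range_eqI[of _ _ "[]"]) (simp add: word_eval_def)
  fix m n assume "m \<in> range (cov_eval std)" "n \<in> range (cov_eval std)"
  then obtain u v where uv: "m = cov_eval std u" "n = cov_eval std v" by blast
  show "m \<otimes>\<^bsub>CG\<^esub> n \<in> range (cov_eval std)"
    by (rule range_eqI[of _ _ "u @ v"]) (simp add: uv CG.word_eval_append)
  show "inv\<^bsub>CG\<^esub> m \<in> range (cov_eval std)"
    by (rule range_eqI[of _ _ "word_inv u"]) (simp add: uv)
qed simp

text \<open>Every element of \<open>CG\<close> is a product of powers of the four generators and
  their four mixed commutators, in the order fixed by the coordinates.\<close>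

lemma cov_eval_surj: obtains w where "cov_eval std w = n"
proof -
  let ?S = "range (cov_eval std)"
  obtain x1 x2 y1 y2 z11 z12 z21 z22 where n: "n = Cov x1 x2 y1 y2 z11 z12 z21 z22" by (cases n)
  note cl = subgroup.m_closed[OF subgroup_range_eval, simplified]
  have pow: "m [^]\<^bsub>CG\<^esub> i \<in> ?S" if "m \<in> ?S" for m and i :: int
    by (rule CG.subgroup_int_pow_closed[OF subgroup_range_eval that])
  have a: "std x [^]\<^bsub>CG\<^esub> i \<in> ?S" for x and i :: int
    by (rule pow, rule range_eqI[of _ _ "gen x"]) simp
  have c: "cov_eval std (word_comm u v) [^]\<^bsub>CG\<^esub> i \<in> ?S" for u v and i :: int
    by (rule pow) blast
  have "n = cov_mult (cov_mult (cov_mult (std B1 [^]\<^bsub>CG\<^esub> y1) (std B2 [^]\<^bsub>CG\<^esub> y2))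
      (cov_mult (std A1 [^]\<^bsub>CG\<^esub> x1) (std A2 [^]\<^bsub>CG\<^esub> x2)))
    (cov_mult (cov_mult (cov_eval std (word_comm (gen A1) (gen B1)) [^]\<^bsub>CG\<^esub> z11)
      (cov_eval std (word_comm (gen A1) (gen B2)) [^]\<^bsub>CG\<^esub> z12))
    (cov_mult (cov_eval std (word_comm (gen A2) (gen B1)) [^]\<^bsub>CG\<^esub> z21)
      (cov_eval std (word_comm (gen A2) (gen B2)) [^]\<^bsub>CG\<^esub> z22)))"
    by (simp add: n int_pow_CG)
  also have "\<dots> \<in> ?S"
    by (intro cl a c)
  finally show ?thesis using that by blast
qed

text \<open>For one direction \<open>m\<close> and \<open>n\<close> are pulled back to words, where
  \<open>canon\<close> is an invariant; the other is \<open>val_canon\<close>. From here on,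
  equality in the group is a matter of integer congruences.\<close>

lemma val_eq_iff: "val m = val n \<longleftrightarrow> canon p m = canon p n"
proof
  assume eq: "val m = val n"
  obtain u v where uv: "cov_eval std u = m" "cov_eval std v = n"
    using cov_eval_surj by metis
  have "cl u = cl v" using cl_eq_val[of u] cl_eq_val[of v] eq by (simp only: uv)
  then show "canon p m = canon p n"
    using canon_eval_eq[of u v] by (simp only: word_class_eq_iff uv)
next
  assume "canon p m = canon p n"
  then have "val (canon p m) = val (canon p n)" by simp
  then show "val m = val n" by (simp only: val_canon)
qed

text \<open>An opaque copy of \<open>val\<close>, whose defining equations would be unfolded by
  simplification.\<close>

definition el :: "cover \<Rightarrow> jk_gen word set" where
  "el n = val n"

lemma el_eq_iff: "el m = el n \<longleftrightarrow> canon p m = canon p n"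
  unfolding el_def by (rule val_eq_iff)

lemma el_closed [simp]: "el n \<in> carrier G"
  unfolding el_def by (rule val_closed)

lemma el_mult: "el m \<otimes>\<^bsub>G\<^esub> el n = el (cov_mult m n)"
  unfolding el_def by (rule val_mult)

lemma el_hom: "el \<in> hom CG G"
  by (rule homI) (simp_all add: el_mult)

lemma el_std: "el (std x) = cl (gen x)"
  unfolding el_def by (rule val_std)

lemma cl_eq_el: "cl w = el (cov_eval std w)"
  unfolding el_def by (rule cl_eq_val)

lemma carrier_eq_range_el: "carrier G = range el"
proof
  show "carrier G \<subseteq> range el" by (auto simp: carrier_G cl_eq_el)
qed auto

lemma el_eq_iff_coordinates:
  "el (Cov x1 x2 y1 y2 z11 z12 z21 z22) = el (Cov x1' x2' y1' y2' z11' z12' z21' z22') \<longleftrightarrow>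
    (\<exists>k1 k2 l1 l2. x1 = x1' + int p * k1 \<and> x2 = x2' + int p * k2 \<and>
      y1 = y1' + int p * l1 \<and> y2 = y2' + int p * l2 \<and>
      int p dvd z11 - z11' + k1 + k2 \<and> int p dvd z12 - z12' \<and>
      int p dvd z21 - z21' + l1 \<and> int p dvd z22 - z22' + l1 + l2)"
  unfolding el_eq_iff by (rule canon_eq_iff[OF p_pos])

lemma el_eq_iff_same_vector:
  "el (Cov x1 x2 y1 y2 z11 z12 z21 z22) = el (Cov x1 x2 y1 y2 w11 w12 w21 w22) \<longleftrightarrow>
    int p dvd z11 - w11 \<and> int p dvd z12 - w12 \<and> int p dvd z21 - w21 \<and> int p dvd z22 - w22"
  unfolding el_eq_iff_coordinates using p_pos by auto

end

section \<open>The congruences for the images of the generators\<close>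

text \<open>
  Modulo the centre, \<open>a1, a2, b1, b2\<close> have images with \<open>(x, y)\<close>-coordinates \<open>(a, b)\<close>, \<open>(c, d)\<close>, \<open>(r, s)\<close>,
  \<open>(m, n)\<close>.  The \<open>p\<close>-th power of an element with coordinates \<open>(x, y)\<close> has an extra term
  \<open>(p choose 2) xi yj\<close>, which matters only for \<open>p = 2\<close>.
\<close>

lemma jk_congruences_odd:
  fixes p :: int
  assumes p: "prime p"
    and A1: "p dvd a1 + a2 - (a1 * s1 - r1 * b1)" "p dvd a1 * s2 - r1 * b2"
      "p dvd b1 - (a2 * s1 - r2 * b1)" "p dvd b1 + b2 - (a2 * s2 - r2 * b2)"
    and A2: "p dvd c1 + c2 - (a1 * s1 - r1 * b1)"
      "p dvd d1 - (a2 * s1 - r2 * b1)" "p dvd d1 + d2 - (a2 * s2 - r2 * b2)"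
    and B1: "p dvd r1 + r2 - (c1 * (s1 + n1) - (r1 + m1) * d1)"
      "p dvd c1 * (s2 + n2) - (r1 + m1) * d2"
      "p dvd s1 - (c2 * (s1 + n1) - (r2 + m2) * d1)"
      "p dvd s1 + s2 - (c2 * (s2 + n2) - (r2 + m2) * d2)"
    and B2: "p dvd m1 + m2 - (c1 * n1 - m1 * d1)" "p dvd c1 * n2 - m1 * d2"
      "p dvd n1 - (c2 * n1 - m2 * d1)" "p dvd n1 + n2 - (c2 * n2 - m2 * d2)"
    and AA: "p dvd a1 * d1 - c1 * b1" "p dvd a1 * d2 - c1 * b2"
    and BB: "p dvd r1 * n1 - m1 * s1" "p dvd r1 * n2 - m1 * s2"
      "p dvd r2 * n1 - m2 * s1" "p dvd r2 * n2 - m2 * s2"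
  shows "(p dvd a1 + a2 \<and> p dvd b1 \<and> p dvd b2 \<and> p dvd c1 + c2 \<and> p dvd d1 \<and> p dvd d2 \<and>
      p dvd r1 + r2 \<and> p dvd s1 \<and> p dvd s2 \<and> p dvd m1 + m2 \<and> p dvd n1 \<and> p dvd n2) \<or>
    (p dvd a1 - 1 \<and> p dvd a2 \<and> p dvd b1 \<and> p dvd b2 \<and> p dvd c1 \<and> p dvd c2 - 1 \<and> p dvd d1 \<and> p dvd d2 \<and>
      p dvd r1 \<and> p dvd r2 \<and> p dvd s1 - 1 \<and> p dvd s2 \<and> p dvd m1 \<and> p dvd m2 \<and> p dvd n1 \<and> p dvd n2 - 1)"
proof -
  note pm = prime_dvd_mult_iff[OF p]
  have u: "p dvd c1 + c2 - a1 - a2" "p dvd d1 - b1" "p dvd d2 - b2"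
    using A1 A2 by algebra+
  \<comment> \<open>Let \<open>T\<close> be the induced linear map. The generators \<open>A1\<close>
    and \<open>A2\<close> have the same \<open>p\<close>-th power, so \<open>T A2 - T A1\<close>
    lies in the kernel of the power map, the line of \<open>A1 - A2\<close>; \<open>k\<close> is its
    coefficient there. For the identity, \<open>k\<close> is -1.\<close>
  define k where "k = c1 - a1"
  have c1: "c1 = a1 + k" by (simp add: k_def)
  have c2: "p dvd c2 - a2 + k" using u(1) unfolding c1 by algebra
  have kb: "p dvd k * b1" "p dvd k * b2"
    using AA u(2,3) unfolding c1 by algebra+
  \<comment> \<open>No \<open>p\<close>-th power has a \<open>c12\<close> component. Comparing the
    \<open>c12\<close> equations of \<open>A1\<close>, \<open>B1\<close> and \<open>B2\<close> gives
    \<open>c1 * s2\<close> and \<open>a1 * s2\<close> the same residue.\<close>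
  have ks: "p dvd k * s2"
    using A1(2) B1(2) B2(2) u(3) unfolding c1 by algebra
  show ?thesis
  proof (cases "p dvd k")
    case True
    have c: "p dvd c1 - a1" "p dvd c2 - a2"
      using True c2 by (simp add: c1) (use True c2 in algebra)
    \<comment> \<open>As \<open>T A1\<close> and \<open>T A2\<close> agree, the relations for
      \<open>A1\<close> and \<open>B2\<close> add up to that for \<open>B1\<close>. Hence
      \<open>T B1 - T B2 - T A1\<close> is again in the kernel of the power map, with coefficient
      \<open>l\<close>.\<close>
    define l where "l = r1 - m1 - a1"
    have r1: "r1 = m1 + a1 + l" by (simp add: l_def)
    have s1: "p dvd s1 - n1 - b1"
      using A1(3) B1(3) B2(3) u c by algebra
    have s2: "p dvd s2 - n2 - b2"
      using A1(4) B1(4) B2(4) u c s1 by algebra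
    have r2: "p dvd r2 - m2 - a2 + l"
      using A1(1) B1(1) B2(1) u c unfolding r1 by algebra
    \<comment> \<open>Inserting this into the commutation of \<open>T B1\<close> with
      \<open>T B2\<close> expresses the \<open>p\<close>-th power of \<open>T B2\<close> as
      \<open>-l\<close> times the commutator of \<open>A1 - A2\<close> with \<open>T B2\<close>;
      these are its four coordinates.\<close>
    have ln: "p dvd l * n1 + m1 + m2" "p dvd l * n2" "p dvd l * n1 - n1" "p dvd l * n2 - (n1 + n2)"
      using BB(1) B2(1) u c s1 unfolding r1 apply algebra
      using BB(2) B2(2) u c s2 unfolding r1 apply algebra
      using BB(3) B2(3) u c s1 r2 apply algebra
      using BB(4) B2(4) u c s2 r2 by algebra
    have n1: "p dvd n1" using ln by algebra
    have n2: "p dvd n2" using ln n1 by algebra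
    have m: "p dvd m1 + m2" using ln n1 by algebra
    have mb: "p dvd m1 * b1" "p dvd m1 * b2" "p dvd m2 * b1" "p dvd m2 * b2"
      using B2(1) m n1 u apply algebra
      using B2(2) n2 u apply algebra
      using B2(3) n1 u apply algebra
      using B2(4) n1 n2 u by algebra
    \<comment> \<open>The same four equations for \<open>T A1\<close> in place of
      \<open>T B2\<close>: its commutator with \<open>T B2\<close> is now known to vanish.\<close>
    have lb: "p dvd l * b1 + (a1 + a2)" "p dvd l * b2" "p dvd l * b1 - b1" "p dvd l * b2 - (b1 + b2)"
      using A1(1) mb n1 s1 unfolding r1 apply algebra
      using A1(2) mb n2 s2 unfolding r1 apply algebra
      using A1(3) mb n1 s1 r2 apply algebra
      using A1(4) mb n2 s2 r2 by algebra
    have b1: "p dvd b1" using lb by algebra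
    have b2: "p dvd b2" using lb b1 by algebra
    have a: "p dvd a1 + a2" using lb b1 by algebra
    have s: "p dvd s1" "p dvd s2"
      using s1 n1 b1 apply algebra
      using s2 n2 b2 by algebra
    have r: "p dvd r1 + r2" using r2 m a unfolding r1 by algebra
    have d: "p dvd c1 + c2" "p dvd d1" "p dvd d2"
      using u b1 b2 a by algebra+
    show ?thesis using n1 n2 m b1 b2 a s r d by blast
  next
    case False
    have b: "p dvd b1" "p dvd b2" "p dvd s2" using kb ks False pm by blast+
    have d: "p dvd d1" "p dvd d2" using b u by algebra+
    have a2s: "p dvd a2 * s1" "p dvd a1 * s1 - a1 - a2"
      using A1(1,3) b by algebra+
    have n1: "p dvd n1 - (1 + k) * s1"
      using B1(3) B2(3) a2s c2 d by algebra
    have n2: "p dvd n2 + k * s1"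
      using B1(4) B2(4) a2s c2 d b n1 by algebra
    show ?thesis
    \<comment> \<open>All \<open>y\<close>-coordinates are by now multiples of \<open>s1\<close>. If
      \<open>s1\<close> vanishes, the image lies on the line of \<open>A1 - A2\<close>; otherwise
      \<open>s1\<close> can be cancelled and only the identity remains.\<close>
    proof (cases "p dvd s1")
      case True
      have "p dvd n1" "p dvd n2" "p dvd a1 + a2"
        using n1 n2 a2s True by algebra+
      moreover from this have "p dvd m1 + m2" "p dvd r1 + r2" "p dvd c1 + c2"
        using B2(1) B1(1) True d u by algebra+
      ultimately show ?thesis using b d True by blast
    next
      case s1: False
      have a2: "p dvd a2" using a2s(1) s1 pm by blast
      have "p dvd c1 * k * s1" using B2(2) n2 d by algebra
      then have c1': "p dvd c1" using False s1 pm by blast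
      have a1: "p dvd a1 + k" using c1' c1 by simp
      have "p dvd k * (s1 - 1)" using a2s a2 a1 by algebra
      then have s1': "p dvd s1 - 1" using False pm by blast
      have n': "p dvd n1 - (1 + k)" "p dvd n2 + k" "p dvd c2 + k"
        using n1 s1' apply algebra
        using n2 s1' apply algebra
        using c2 a2 by algebra
      \<comment> \<open>With \<open>n1\<close> equal to 1 + k and \<open>c2\<close> equal to -k, the
        \<open>c21\<close> equation of \<open>B2\<close> becomes this square.\<close>
      have "p dvd (1 + k) * (1 + k)"
        using B2(3) d(1) n' by algebra
      then have k: "p dvd 1 + k" using pm by blast
      have n: "p dvd n1" "p dvd n2 - 1" using n1 n2 k s1' by algebra+
      have ac: "p dvd a1 - 1" "p dvd c2 - 1" using a1 c2 a2 k by algebra+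
      have "p dvd r1" "p dvd m1" "p dvd r2" "p dvd m2"
        using BB n b s1' by algebra+
      then show ?thesis using n ac b d s1' c1' a2 by blast
    qed
  qed
qed

text \<open>The extra terms make the power map nonlinear, which breaks the argument for odd primes.
  Passing to parities leaves a propositional problem in sixteen variables.\<close>

lemma jk_congruences_two:
  assumes
    A1: "(2::int) dvd a1 + a2 + a1 * b1 - (a1 * s1 - r1 * b1)" "2 dvd a1 * b2 - (a1 * s2 - r1 * b2)"
      "2 dvd b1 + a2 * b1 - (a2 * s1 - r2 * b1)" "2 dvd b1 + b2 + a2 * b2 - (a2 * s2 - r2 * b2)"
    and A2: "2 dvd c1 + c2 + c1 * d1 - (a1 * s1 - r1 * b1)" "2 dvd c1 * d2 - (a1 * s2 - r1 * b2)"
      "2 dvd d1 + c2 * d1 - (a2 * s1 - r2 * b1)" "2 dvd d1 + d2 + c2 * d2 - (a2 * s2 - r2 * b2)"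
    and B1: "2 dvd r1 + r2 + r1 * s1 - (c1 * (s1 + n1) - (r1 + m1) * d1)"
      "2 dvd r1 * s2 - (c1 * (s2 + n2) - (r1 + m1) * d2)"
      "2 dvd s1 + r2 * s1 - (c2 * (s1 + n1) - (r2 + m2) * d1)"
      "2 dvd s1 + s2 + r2 * s2 - (c2 * (s2 + n2) - (r2 + m2) * d2)"
    and B2: "2 dvd m1 + m2 + m1 * n1 - (c1 * n1 - m1 * d1)" "2 dvd m1 * n2 - (c1 * n2 - m1 * d2)"
      "2 dvd n1 + m2 * n1 - (c2 * n1 - m2 * d1)" "2 dvd n1 + n2 + m2 * n2 - (c2 * n2 - m2 * d2)"
    and AA: "2 dvd a1 * d1 - c1 * b1" "2 dvd a1 * d2 - c1 * b2"
      "2 dvd a2 * d1 - c2 * b1" "2 dvd a2 * d2 - c2 * b2"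
    and BB: "2 dvd r1 * n1 - m1 * s1" "2 dvd r1 * n2 - m1 * s2"
      "2 dvd r2 * n1 - m2 * s1" "2 dvd r2 * n2 - m2 * s2"
  shows "(2 dvd a1 + a2 \<and> 2 dvd b1 \<and> 2 dvd b2 \<and> 2 dvd c1 + c2 \<and> 2 dvd d1 \<and> 2 dvd d2 \<and>
      2 dvd r1 + r2 \<and> 2 dvd s1 \<and> 2 dvd s2 \<and> 2 dvd m1 + m2 \<and> 2 dvd n1 \<and> 2 dvd n2) \<or>
    (2 dvd a1 - 1 \<and> 2 dvd a2 \<and> 2 dvd b1 \<and> 2 dvd b2 \<and> 2 dvd c1 \<and> 2 dvd c2 - 1 \<and> 2 dvd d1 \<and> 2 dvd d2 \<and>
      2 dvd r1 \<and> 2 dvd r2 \<and> 2 dvd s1 - 1 \<and> 2 dvd s2 \<and> 2 dvd m1 \<and> 2 dvd m2 \<and> 2 dvd n1 \<and> 2 dvd n2 - 1)"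
  using assms unfolding even_diff_iff even_add even_mult_iff even_diff
  by (simp only: even_add even_mult_iff even_diff odd_one simp_thms) sat

section \<open>Endomorphisms in coordinates\<close>

fun lin :: "(jk_gen \<Rightarrow> int) \<Rightarrow> cover \<Rightarrow> int" where
  "lin f (Cov x1 x2 y1 y2 _ _ _ _) = x1 * f A1 + x2 * f A2 + y1 * f B1 + y2 * f B2"

type_synonym quad = "(jk_gen \<Rightarrow> int) \<times> (jk_gen \<Rightarrow> int) \<times> (jk_gen \<Rightarrow> int) \<times> (jk_gen \<Rightarrow> int)"

text \<open>Stands for the lifts of \<open>T = 1\<close>; the four forms are the coordinates of a
  linear map from the vector part to the centre.\<close>

fun shear :: "quad \<Rightarrow> cover \<Rightarrow> cover" where
  "shear (a, b, c, d) n = cov_mult n (Cov 0 0 0 0 (lin a n) (lin b n) (lin c n) (lin d n))"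

text \<open>Stands for the lifts of \<open>T v = l(v) d\<close>: the first two coordinates are
  \<open>lin l n\<close> times \<open>a1 - a2\<close>.\<close>

fun collapse :: "(jk_gen \<Rightarrow> int) \<Rightarrow> quad \<Rightarrow> cover \<Rightarrow> cover" where
  "collapse l (a, b, c, d) n = Cov (lin l n) (- lin l n) 0 0 (lin a n) (lin b n) (lin c n) (lin d n)"

lemma lin_std [simp]: "lin f (std g) = f g"
  by (cases g) simp_all

lemma shear_hom: "shear q \<in> hom CG CG"
proof (rule homI)
  fix m n
  show "shear q (m \<otimes>\<^bsub>CG\<^esub> n) = shear q m \<otimes>\<^bsub>CG\<^esub> shear q n"
    by (cases q; cases m; cases n) (simp add: algebra_simps)
qed simp

lemma collapse_hom: "collapse l q \<in> hom CG CG"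
proof (rule homI)
  fix m n
  show "collapse l q (m \<otimes>\<^bsub>CG\<^esub> n) = collapse l q m \<otimes>\<^bsub>CG\<^esub> collapse l q n"
    by (cases q; cases m; cases n) (simp add: algebra_simps)
qed simp

context jk
begin

section \<open>Endomorphisms induced by homomorphisms of the covering group\<close>

definition liftable :: "(cover \<Rightarrow> cover) \<Rightarrow> bool" where
  "liftable h \<longleftrightarrow> h \<in> hom CG CG \<and> (\<forall>m n. el m = el n \<longrightarrow> el (h m) = el (h n))"

text \<open>\<open>inv_into\<close> picks an arbitrary integer representative;
  \<open>liftable\<close> makes the result independent of it. The restriction yields an extensional
  function, as \<open>End_monoid\<close> requires.\<close>

definition induced :: "(cover \<Rightarrow> cover) \<Rightarrow> jk_gen word set \<Rightarrow> jk_gen word set" where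
  "induced h = (\<lambda>X\<in>carrier G. el (h (inv_into UNIV el X)))"

lemma induced_el: "liftable h \<Longrightarrow> induced h (el n) = el (h n)"
proof -
  assume "liftable h"
  moreover have "el (inv_into UNIV el (el n)) = el n"
    by (simp add: f_inv_into_f)
  ultimately have "el (h (inv_into UNIV el (el n))) = el (h n)"
    unfolding liftable_def by blast
  then show ?thesis by (simp add: induced_def)
qed

lemma liftable_comp:
  assumes "liftable h" "liftable h'"
  shows "liftable (h \<circ> h')"
  unfolding liftable_def
proof
  have "h \<in> hom CG CG" "h' \<in> hom CG CG"
    using assms unfolding liftable_def by blast+
  then show "h \<circ> h' \<in> hom CG CG"
    by (simp add: hom_def)
  show "\<forall>m n. el m = el n \<longrightarrow> el ((h \<circ> h') m) = el ((h \<circ> h') n)"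
    using assms unfolding liftable_def o_apply by blast
qed

text \<open>The vector part is kept, so the carries are kept too, and the linear forms change by
  multiples of \<open>p\<close> only.\<close>

lemma liftable_shear: "liftable (shear q)"
  unfolding liftable_def
proof (intro conjI allI impI shear_hom)
  fix m n assume eq: "el m = el n"
  obtain x1 x2 y1 y2 z11 z12 z21 z22 where m: "m = Cov x1 x2 y1 y2 z11 z12 z21 z22" by (cases m)
  obtain x1' x2' y1' y2' z11' z12' z21' z22' where n: "n = Cov x1' x2' y1' y2' z11' z12' z21' z22'"
    by (cases n)
  obtain a b c d where q: "q = (a, b, c, d)" by (cases q)
  from eq obtain k1 k2 l1 l2 where e: "x1 = x1' + int p * k1" "x2 = x2' + int p * k2"
      "y1 = y1' + int p * l1" "y2 = y2' + int p * l2"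
    and dv: "int p dvd z11 - z11' + k1 + k2" "int p dvd z12 - z12'"
      "int p dvd z21 - z21' + l1" "int p dvd z22 - z22' + l1 + l2"
    unfolding m n el_eq_iff_coordinates by blast
  show "el (shear q m) = el (shear q n)"
    unfolding m n q shear.simps cov_mult.simps el_eq_iff_coordinates lin.simps
    apply (rule exI[of _ k1], rule exI[of _ k2], rule exI[of _ l1], rule exI[of _ l2])
    apply (simp add: e)
    apply (intro conjI)
    subgoal using dv(1) by algebra
    subgoal using dv(2) by algebra
    subgoal using dv(3) by algebra
    subgoal using dv(4) by algebra
    done
qed

text \<open>The direction \<open>a1 - a2\<close> has trivial \<open>p\<close>-th power: the carries
  \<open>?k\<close> and \<open>- ?k\<close> of its two coordinates cancel in the \<open>c11\<close>
  coordinate.\<close>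

lemma liftable_collapse: "liftable (collapse l q)"
  unfolding liftable_def
proof (intro conjI allI impI collapse_hom)
  fix m n assume eq: "el m = el n"
  obtain x1 x2 y1 y2 z11 z12 z21 z22 where m: "m = Cov x1 x2 y1 y2 z11 z12 z21 z22" by (cases m)
  obtain x1' x2' y1' y2' z11' z12' z21' z22' where n: "n = Cov x1' x2' y1' y2' z11' z12' z21' z22'"
    by (cases n)
  obtain a b c d where q: "q = (a, b, c, d)" by (cases q)
  from eq obtain k1 k2 l1 l2 where e: "x1 = x1' + int p * k1" "x2 = x2' + int p * k2"
      "y1 = y1' + int p * l1" "y2 = y2' + int p * l2"
    unfolding m n el_eq_iff_coordinates by blast
  let ?k = "lin l (Cov k1 k2 l1 l2 0 0 0 0)"
  have *: "lin f m - lin f n = int p * lin f (Cov k1 k2 l1 l2 0 0 0 0)" for f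
    by (simp add: m n e algebra_simps)
  then have lin: "lin f m = lin f n + int p * lin f (Cov k1 k2 l1 l2 0 0 0 0)" for f
    by (metis add.commute diff_add_cancel)
  show "el (collapse l q m) = el (collapse l q n)"
    unfolding q collapse.simps el_eq_iff_coordinates
    by (rule exI[of _ ?k], rule exI[of _ "- ?k"], rule exI[of _ 0], rule exI[of _ 0])
      (simp add: lin del: lin.simps)
qed

lemma induced_in_End:
  assumes h: "liftable h"
  shows "induced h \<in> carrier (End_monoid G)"
proof -
  have hm: "h (cov_mult m n) = cov_mult (h m) (h n)" for m n
    using h by (auto simp: liftable_def hom_def)
  have "induced h \<in> hom G G"
  proof (rule homI)
    fix X Y assume "X \<in> carrier G" "Y \<in> carrier G"
    then obtain m n where "X = el m" "Y = el n" by (auto simp: carrier_eq_range_el)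
    then show "induced h (X \<otimes>\<^bsub>G\<^esub> Y) = induced h X \<otimes>\<^bsub>G\<^esub> induced h Y"
      by (simp add: el_mult induced_el[OF h] hm)
  qed (auto simp: carrier_eq_range_el induced_el[OF h])
  then show ?thesis
    by (simp add: End_monoid_def induced_def)
qed

lemma End_eqI:
  assumes "\<phi> \<in> carrier (End_monoid G)" "\<psi> \<in> carrier (End_monoid G)"
    and "\<And>g. \<phi> (el (std g)) = \<psi> (el (std g))"
  shows "\<phi> = \<psi>"
proof (rule extensionalityI[of _ "carrier G"])
  show "\<phi> \<in> extensional (carrier G)" "\<psi> \<in> extensional (carrier G)"
    using assms by (simp_all add: End_monoid_def)
  have hom: "\<phi> \<in> hom G G" "\<psi> \<in> hom G G"
    using assms by (simp_all add: End_monoid_def)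
  fix X assume "X \<in> carrier G"
  then obtain w where X: "X = cl w" by (auto simp: carrier_G)
  have "\<phi> (cl w) = word_eval G (\<lambda>g. \<phi> (cl (gen g))) w"
    by (subst cl_eval) (rule word_eval_hom[OF cl_gen_Pi group_axioms hom(1)])
  also have "\<dots> = word_eval G (\<lambda>g. \<psi> (cl (gen g))) w"
    using assms(3) by (simp add: el_std)
  also have "\<dots> = \<psi> (cl w)"
    by (subst (2) cl_eval) (rule word_eval_hom[OF cl_gen_Pi group_axioms hom(2), symmetric])
  finally show "\<phi> X = \<psi> X" by (simp only: X)
qed

text \<open>Allows the defining relations to be tested on arbitrary integer lifts \<open>F\<close>
  of the images of the generators.\<close>

lemma End_word_eval:
  assumes \<phi>: "\<phi> \<in> carrier (End_monoid G)" and F: "\<And>g. \<phi> (cl (gen g)) = el (F g)"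
  shows "\<phi> (cl w) = el (cov_eval F w)"
proof -
  have hom: "\<phi> \<in> hom G G"
    using \<phi> by (simp add: End_monoid_def)
  have "\<phi> (cl w) = word_eval G (\<lambda>g. \<phi> (cl (gen g))) w"
    by (subst cl_eval) (rule word_eval_hom[OF cl_gen_Pi group_axioms hom])
  also have "\<dots> = el (cov_eval F w)"
    unfolding F by (rule CG.word_eval_hom[OF _ group_axioms el_hom, symmetric]) simp
  finally show ?thesis .
qed

lemma induced_mult:
  assumes "liftable h" "liftable h'"
  shows "induced h \<otimes>\<^bsub>End_monoid G\<^esub> induced h' = induced (h \<circ> h')"
proof -
  have "compose (carrier G) (induced h) (induced h') X = induced (h \<circ> h') X" if X: "X \<in> carrier G" for X
  proof -
    obtain n where "X = el n" using X by (auto simp: carrier_eq_range_el)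
    moreover have "liftable (h \<circ> h')"
      by (rule liftable_comp[OF assms])
    ultimately show ?thesis using assms by (simp add: compose_eq induced_el)
  qed
  then have "compose (carrier G) (induced h) (induced h') = induced (h \<circ> h')"
    by (intro extensionalityI[of _ "carrier G"]) (simp_all add: induced_def)
  then show ?thesis by (simp add: End_monoid_def)
qed

section \<open>Classification of the endomorphisms\<close>

lemma canon_p_multiple_eq_iff:
  "canon p (Cov (int p * x1) (int p * x2) (int p * y1) (int p * y2) z11 z12 z21 z22) =
     canon p (Cov 0 0 0 0 w11 w12 w21 w22) \<longleftrightarrow>
   int p dvd z11 - w11 + x1 + x2 \<and> int p dvd z12 - w12 \<and>
   int p dvd z21 - w21 + y1 \<and> int p dvd z22 - w22 + y1 + y2"
  unfolding canon_eq_iff[OF p_pos] using p_pos by auto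

lemma cov_commutator:
  "cov_mult (cov_mult (cov_mult (cov_inv (Cov x1 x2 y1 y2 z11 z12 z21 z22))
      (cov_inv (Cov x1' x2' y1' y2' w11 w12 w21 w22)))
      (Cov x1 x2 y1 y2 z11 z12 z21 z22)) (Cov x1' x2' y1' y2' w11 w12 w21 w22) =
    Cov 0 0 0 0 (x1 * y1' - x1' * y1) (x1 * y2' - x1' * y2) (x2 * y1' - x2' * y1) (x2 * y2' - x2' * y2)"
  by (simp add: algebra_simps)

text \<open>Replacing a vector by a congruent one produces carries, which the central coordinates
  absorb.\<close>

lemma el_change_vector:
  assumes "int p dvd x1 - x1'" "int p dvd x2 - x2'" "int p dvd y1 - y1'" "int p dvd y2 - y2'"
  shows "\<exists>w11 w12 w21 w22. el (Cov x1 x2 y1 y2 z11 z12 z21 z22) = el (Cov x1' x2' y1' y2' w11 w12 w21 w22)"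
proof -
  obtain k1 k2 l1 l2 where k: "x1 - x1' = int p * k1" "x2 - x2' = int p * k2"
    "y1 - y1' = int p * l1" "y2 - y2' = int p * l2"
    using assms by (auto elim!: dvdE)
  show ?thesis
    unfolding el_eq_iff_coordinates
    by (rule exI[of _ "z11 + k1 + k2"], rule exI[of _ "z12"], rule exI[of _ "z21 + l1"],
        rule exI[of _ "z22 + l1 + l2"], rule exI[of _ k1], rule exI[of _ k2], rule exI[of _ l1],
        rule exI[of _ l2]) (use k in \<open>simp add: algebra_simps\<close>)
qed

text \<open>The images of the generators satisfy the defining relations, and comparing canonical
  coordinates turns these into the congruences solved above.\<close>

lemma End_vector_cases:
  assumes \<phi>: "\<phi> \<in> carrier (End_monoid G)"
  and F: "\<And>g. \<phi> (cl (gen g)) = el (F g)"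
  and A1: "F A1 = Cov a1 a2 b1 b2 e11 e12 e21 e22"
  and A2: "F A2 = Cov c1 c2 d1 d2 f11 f12 f21 f22"
  and B1: "F B1 = Cov r1 r2 s1 s2 g11 g12 g21 g22"
  and B2: "F B2 = Cov m1 m2 n1 n2 h11 h12 h21 h22"
  defines "q \<equiv> int p"
  shows "(q dvd a1 + a2 \<and> q dvd b1 \<and> q dvd b2 \<and> q dvd c1 + c2 \<and> q dvd d1 \<and> q dvd d2 \<and>
      q dvd r1 + r2 \<and> q dvd s1 \<and> q dvd s2 \<and> q dvd m1 + m2 \<and> q dvd n1 \<and> q dvd n2) \<or>
    (q dvd a1 - 1 \<and> q dvd a2 \<and> q dvd b1 \<and> q dvd b2 \<and> q dvd c1 \<and> q dvd c2 - 1 \<and> q dvd d1 \<and> q dvd d2 \<and>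
      q dvd r1 \<and> q dvd r2 \<and> q dvd s1 - 1 \<and> q dvd s2 \<and> q dvd m1 \<and> q dvd m2 \<and> q dvd n1 \<and> q dvd n2 - 1)"
proof -
  have rel: "canon p (cov_eval F u) = canon p (cov_eval F v)" if "(u, v) \<in> JK_rels p" for u v
    using cl_rel[OF that] End_word_eval[OF \<phi> F, of u] End_word_eval[OF \<phi> F, of v]
    by (simp flip: el_eq_iff)
  \<comment> \<open>The coefficient of the mixed products in a \<open>p\<close>-th power: it is 1
    for \<open>p = 2\<close> and divisible by \<open>p\<close> for odd \<open>p\<close>.\<close>
  define C where "C = int (p choose 2)"
  note simps = nat_pow_CG CG.word_eval_append A1 A2 B1 B2 cov_commutator
    canon_p_multiple_eq_iff[folded q_def] C_def[symmetric] q_def[symmetric]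
  have nil: "cov_eval F [] = Cov 0 0 0 0 0 0 0 0"
    by (simp add: word_eval_def)
  have "canon p (cov_eval F (word_pow (gen A1) p)) = canon p (cov_eval F (word_comm (gen A1) (gen B1)))"
    by (rule rel) (simp add: JK_rels_def)
  then have hA1: "q dvd q * e11 + C * (a1 * b1) - (a1 * s1 - r1 * b1) + a1 + a2"
      "q dvd q * e12 + C * (a1 * b2) - (a1 * s2 - r1 * b2)"
      "q dvd q * e21 + C * (a2 * b1) - (a2 * s1 - r2 * b1) + b1"
      "q dvd q * e22 + C * (a2 * b2) - (a2 * s2 - r2 * b2) + b1 + b2"
    by (simp_all add: simps del: canon.simps cov_mult.simps cov_inv.simps)
  have "canon p (cov_eval F (word_pow (gen A2) p)) = canon p (cov_eval F (word_comm (gen A1) (gen B1)))"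
    by (rule rel) (simp add: JK_rels_def)
  then have hA2: "q dvd q * f11 + C * (c1 * d1) - (a1 * s1 - r1 * b1) + c1 + c2"
      "q dvd q * f12 + C * (c1 * d2) - (a1 * s2 - r1 * b2)"
      "q dvd q * f21 + C * (c2 * d1) - (a2 * s1 - r2 * b1) + d1"
      "q dvd q * f22 + C * (c2 * d2) - (a2 * s2 - r2 * b2) + d1 + d2"
    by (simp_all add: simps del: canon.simps cov_mult.simps cov_inv.simps)
  have "canon p (cov_eval F (word_pow (gen B1) p)) = canon p (cov_eval F (word_comm (gen A2) (gen B1 @ gen B2)))"
    by (rule rel) (simp add: JK_rels_def)
  \<comment> \<open>The central coordinates may stay unknown, since commutators do not see
    them.\<close>
  moreover obtain w11 w12 w21 w22 where
    "cov_eval F (gen B1 @ gen B2) = Cov (r1 + m1) (r2 + m2) (s1 + n1) (s2 + n2) w11 w12 w21 w22"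
    by (simp add: CG.word_eval_append B1 B2)
  ultimately have hB1: "q dvd q * g11 + C * (r1 * s1) - (c1 * (s1 + n1) - (r1 + m1) * d1) + r1 + r2"
      "q dvd q * g12 + C * (r1 * s2) - (c1 * (s2 + n2) - (r1 + m1) * d2)"
      "q dvd q * g21 + C * (r2 * s1) - (c2 * (s1 + n1) - (r2 + m2) * d1) + s1"
      "q dvd q * g22 + C * (r2 * s2) - (c2 * (s2 + n2) - (r2 + m2) * d2) + s1 + s2"
    by (simp_all add: nat_pow_CG A2 B1 cov_commutator canon_p_multiple_eq_iff[folded q_def] C_def[symmetric] q_def[symmetric]
      del: canon.simps cov_mult.simps cov_inv.simps)
  have "canon p (cov_eval F (word_pow (gen B2) p)) = canon p (cov_eval F (word_comm (gen A2) (gen B2)))"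
    by (rule rel) (simp add: JK_rels_def)
  then have hB2: "q dvd q * h11 + C * (m1 * n1) - (c1 * n1 - m1 * d1) + m1 + m2"
      "q dvd q * h12 + C * (m1 * n2) - (c1 * n2 - m1 * d2)"
      "q dvd q * h21 + C * (m2 * n1) - (c2 * n1 - m2 * d1) + n1"
      "q dvd q * h22 + C * (m2 * n2) - (c2 * n2 - m2 * d2) + n1 + n2"
    by (simp_all add: simps del: canon.simps cov_mult.simps cov_inv.simps)
  have "canon p (cov_eval F []) = canon p (cov_eval F (word_comm (gen A1) (gen A2)))"
    by (rule rel[symmetric]) (simp add: JK_rels_def)
  then have hAA: "q dvd a1 * d1 - c1 * b1" "q dvd a1 * d2 - c1 * b2" "q dvd a2 * d1 - c2 * b1" "q dvd a2 * d2 - c2 * b2"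
    by (simp_all add: nil simps el_eq_iff_same_vector[unfolded el_eq_iff, folded q_def] dvd_diff_commute
      del: canon.simps cov_mult.simps cov_inv.simps)
  have "canon p (cov_eval F []) = canon p (cov_eval F (word_comm (gen B1) (gen B2)))"
    by (rule rel[symmetric]) (simp add: JK_rels_def)
  then have hBB: "q dvd r1 * n1 - m1 * s1" "q dvd r1 * n2 - m1 * s2" "q dvd r2 * n1 - m2 * s1" "q dvd r2 * n2 - m2 * s2"
    by (simp_all add: nil simps el_eq_iff_same_vector[unfolded el_eq_iff, folded q_def] dvd_diff_commute
      del: canon.simps cov_mult.simps cov_inv.simps)
  \<comment> \<open>The terms \<open>q * e\<close> come from the central coordinates of the images.
    Discarding them leaves conditions on the vectors alone.\<close>
  have drop: "q dvd q * e + x - y + u \<Longrightarrow> q dvd u + x - y"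
    "q dvd q * e + x - y + u + v \<Longrightarrow> q dvd u + v + x - y"
    "q dvd q * e + x - y \<Longrightarrow> q dvd x - y" for e x y u v
    by algebra+
  note h = hA1(1)[THEN drop(2)] hA1(2)[THEN drop(3)] hA1(3)[THEN drop(1)] hA1(4)[THEN drop(2)]
    hA2(1)[THEN drop(2)] hA2(2)[THEN drop(3)] hA2(3)[THEN drop(1)] hA2(4)[THEN drop(2)]
    hB1(1)[THEN drop(2)] hB1(2)[THEN drop(3)] hB1(3)[THEN drop(1)] hB1(4)[THEN drop(2)]
    hB2(1)[THEN drop(2)] hB2(2)[THEN drop(3)] hB2(3)[THEN drop(1)] hB2(4)[THEN drop(2)]
  show ?thesis
  proof (cases "p = 2")
    case True
    then have 1: "C = 1" "q = 2" by (simp_all add: C_def q_def)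
    show ?thesis
      unfolding 1 by (rule jk_congruences_two; rule h[unfolded 1 mult_1] hAA[unfolded 1] hBB[unfolded 1])
  next
    case False
    then have "odd p" using prime by (auto simp: prime_nat_iff)
    then obtain k where "p = 2 * k + 1" by (rule oddE)
    then have "p choose 2 = p * k" by (simp add: choose_two)
    then have dC: "q dvd C" by (simp add: C_def q_def)
    have q: "prime q" using prime by (simp add: q_def)
    have drop: "q dvd u + C * x - y \<Longrightarrow> q dvd u - y" "q dvd C * x - y \<Longrightarrow> q dvd y" for x y u
      using dC by algebra+
    note h' = h(1)[THEN drop(1)] h(2)[THEN drop(2)] h(3)[THEN drop(1)] h(4)[THEN drop(1)]
      h(5)[THEN drop(1)] h(7)[THEN drop(1)] h(8)[THEN drop(1)]
      h(9)[THEN drop(1)] h(10)[THEN drop(2)] h(11)[THEN drop(1)] h(12)[THEN drop(1)]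
      h(13)[THEN drop(1)] h(14)[THEN drop(2)] h(15)[THEN drop(1)] h(16)[THEN drop(1)]
    show ?thesis
      by (rule jk_congruences_odd[OF q h' hAA(1,2) hBB])
  qed
qed

text \<open>Congruent vectors are replaced by exact ones at the cost of new central coordinates; an
  endomorphism is then determined by its values on the generators.\<close>

lemma End_cases:
  assumes \<phi>: "\<phi> \<in> carrier (End_monoid G)"
  obtains q where "\<phi> = induced (shear q)" | l q where "\<phi> = induced (collapse l q)"
proof -
  have hom: "\<phi> \<in> hom G G"
    using \<phi> by (simp add: End_monoid_def)
  have "\<exists>n. \<phi> (cl (gen g)) = el n" for g
    using hom_in_carrier[OF hom cl_in_carrier[of "gen g"]] unfolding carrier_eq_range_el by blast
  then obtain F where F: "\<And>g. \<phi> (cl (gen g)) = el (F g)"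
    using choice[of "\<lambda>g n. \<phi> (cl (gen g)) = el n"] by blast
  obtain a1 a2 b1 b2 e11 e12 e21 e22 where A1: "F A1 = Cov a1 a2 b1 b2 e11 e12 e21 e22" by (cases "F A1")
  obtain c1 c2 d1 d2 f11 f12 f21 f22 where A2: "F A2 = Cov c1 c2 d1 d2 f11 f12 f21 f22" by (cases "F A2")
  obtain r1 r2 s1 s2 g11 g12 g21 g22 where B1: "F B1 = Cov r1 r2 s1 s2 g11 g12 g21 g22" by (cases "F B1")
  obtain m1 m2 n1 n2 h11 h12 h21 h22 where B2: "F B2 = Cov m1 m2 n1 n2 h11 h12 h21 h22" by (cases "F B2")
  from End_vector_cases[OF \<phi> F A1 A2 B1 B2] show ?thesis
  proof (elim disjE conjE)
    assume dv: "int p dvd a1 + a2" "int p dvd b1" "int p dvd b2" "int p dvd c1 + c2" "int p dvd d1" "int p dvd d2"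
      "int p dvd r1 + r2" "int p dvd s1" "int p dvd s2" "int p dvd m1 + m2" "int p dvd n1" "int p dvd n2"
    have "\<exists>l a b c d. el (F g) = el (Cov l (- l) 0 0 a b c d)" for g
    proof (cases g)
      case A1': A1
      show ?thesis unfolding A1' A1 by (rule exI[of _ a1], rule el_change_vector) (use dv in \<open>simp_all add: add.commute\<close>)
    next
      case A2': A2
      show ?thesis unfolding A2' A2 by (rule exI[of _ c1], rule el_change_vector) (use dv in \<open>simp_all add: add.commute\<close>)
    next
      case B1': B1
      show ?thesis unfolding B1' B1 by (rule exI[of _ r1], rule el_change_vector) (use dv in \<open>simp_all add: add.commute\<close>)
    next
      case B2': B2
      show ?thesis unfolding B2' B2 by (rule exI[of _ m1], rule el_change_vector) (use dv in \<open>simp_all add: add.commute\<close>)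
    qed
    then obtain l a b c d where *: "\<And>g. el (F g) = el (Cov (l g) (- l g) 0 0 (a g) (b g) (c g) (d g))"
      by metis
    have "\<phi> = induced (collapse l (a, b, c, d))"
      by (rule End_eqI[OF \<phi> induced_in_End[OF liftable_collapse]])
        (simp add: induced_el liftable_collapse F[folded el_std] *)
    then show ?thesis by (rule that(2))
  next
    assume dv: "int p dvd a1 - 1" "int p dvd a2" "int p dvd b1" "int p dvd b2" "int p dvd c1" "int p dvd c2 - 1"
      "int p dvd d1" "int p dvd d2" "int p dvd r1" "int p dvd r2" "int p dvd s1 - 1" "int p dvd s2"
      "int p dvd m1" "int p dvd m2" "int p dvd n1" "int p dvd n2 - 1"
    have "\<exists>a b c d. el (F g) = el (cov_mult (std g) (Cov 0 0 0 0 a b c d))" for g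
    proof (cases g)
      case A1': A1
      show ?thesis unfolding A1' A1 by simp (rule el_change_vector; use dv in simp)
    next
      case A2': A2
      show ?thesis unfolding A2' A2 by simp (rule el_change_vector; use dv in simp)
    next
      case B1': B1
      show ?thesis unfolding B1' B1 by simp (rule el_change_vector; use dv in simp)
    next
      case B2': B2
      show ?thesis unfolding B2' B2 by simp (rule el_change_vector; use dv in simp)
    qed
    then obtain a b c d where *: "\<And>g. el (F g) = el (cov_mult (std g) (Cov 0 0 0 0 (a g) (b g) (c g) (d g)))"
      by metis
    have "\<phi> = induced (shear (a, b, c, d))"
      by (rule End_eqI[OF \<phi> induced_in_End[OF liftable_shear]])
        (simp add: induced_el liftable_shear F[folded el_std] *)
    then show ?thesis by (rule that(1))
  qed
qed

end

section \<open>The conjugation action\<close>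

lemma shear_shear: "shear (a, b, c, d) (shear (a', b', c', d') n) =
    shear (\<lambda>g. a g + a' g, \<lambda>g. b g + b' g, \<lambda>g. c g + c' g, \<lambda>g. d g + d' g) n"
  by (cases n) (simp add: algebra_simps)

lemma shear_zero: "shear (\<lambda>_. 0, \<lambda>_. 0, \<lambda>_. 0, \<lambda>_. 0) n = n"
  by (cases n) simp

text \<open>\<open>collapse\<close> reads only the vector part, which \<open>shear\<close> leaves
  alone.\<close>

lemma collapse_shear: "collapse l q (shear q' n) = collapse l q n"
  by (cases n; cases q; cases q') simp

text \<open>On \<open>lin l n\<close> times \<open>a1 - a2\<close>, a linear form \<open>f\<close>
  takes the value \<open>(f A1 - f A2) * lin l n\<close>.\<close>

lemma shear_collapse:
  "shear (a', b', c', d') (collapse l (a, b, c, d) n) =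
    collapse l (\<lambda>g. a g + (a' A1 - a' A2) * l g, \<lambda>g. b g + (b' A1 - b' A2) * l g,
      \<lambda>g. c g + (c' A1 - c' A2) * l g, \<lambda>g. d g + (d' A1 - d' A2) * l g) n"
  by (cases n) (simp add: algebra_simps)

lemma UNIV_jk_gen: "UNIV = {A1, A2, B1, B2}"
  using jk_gen.exhaust by auto

instance jk_gen :: finite
  by standard (simp add: UNIV_jk_gen)

context jk
begin

abbreviation M where "M \<equiv> End_monoid G"

sublocale M: monoid M
  by (rule monoid_End_monoid)

section \<open>Parametrisation of the endomorphisms by residues modulo \<open>p\<close>\<close>

definition reduce :: "(jk_gen \<Rightarrow> int) \<Rightarrow> jk_gen \<Rightarrow> int" where
  "reduce f = (\<lambda>g. f g mod int p)"

definition residue_funs :: "(jk_gen \<Rightarrow> int) set" where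
  "residue_funs = (UNIV \<rightarrow>\<^sub>E {0..<int p})"

lemma reduce_eq_iff: "reduce f = reduce f' \<longleftrightarrow> (\<forall>g. int p dvd f g - f' g)"
  by (simp add: reduce_def fun_eq_iff mod_eq_dvd_iff)

lemma reduce_in_residue_funs [simp]: "reduce f \<in> residue_funs"
  using p_pos by (simp add: reduce_def residue_funs_def PiE_def Pi_iff)

lemma reduce_residue [simp]: "f \<in> residue_funs \<Longrightarrow> reduce f = f"
  by (auto simp: reduce_def residue_funs_def PiE_def Pi_iff)

lemma card_residue_funs: "card residue_funs = p ^ 4"
proof -
  have "card (UNIV :: jk_gen set) = 4" by (simp add: UNIV_jk_gen)
  then show ?thesis by (simp add: residue_funs_def card_funcsetE)
qed

lemma finite_residue_funs: "finite residue_funs"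
  unfolding residue_funs_def by (rule finite_PiE) simp_all

abbreviation quads :: "quad set" where
  "quads \<equiv> residue_funs \<times> residue_funs \<times> residue_funs \<times> residue_funs"

lemma card_quads: "card quads = p ^ 16"
  by (simp add: card_cartesian_product card_residue_funs flip: power_add)

lemma induced_eq_iff:
  assumes "liftable h" "liftable h'"
  shows "induced h = induced h' \<longleftrightarrow> (\<forall>g. el (h (std g)) = el (h' (std g)))"
proof
  assume "induced h = induced h'"
  then show "\<forall>g. el (h (std g)) = el (h' (std g))"
    by (metis assms induced_el)
next
  assume "\<forall>g. el (h (std g)) = el (h' (std g))"
  then show "induced h = induced h'"
    using assms by (intro End_eqI induced_in_End) (simp_all add: induced_el)
qed

lemma induced_shear_eq_iff:
  "induced (shear (a, b, c, d)) = induced (shear (a', b', c', d')) \<longleftrightarrow>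
    reduce a = reduce a' \<and> reduce b = reduce b' \<and> reduce c = reduce c' \<and> reduce d = reduce d'"
proof -
  have "el (cov_mult n (Cov 0 0 0 0 z11 z12 z21 z22)) = el (cov_mult n (Cov 0 0 0 0 w11 w12 w21 w22)) \<longleftrightarrow>
    int p dvd z11 - w11 \<and> int p dvd z12 - w12 \<and> int p dvd z21 - w21 \<and> int p dvd z22 - w22"
    for n z11 z12 z21 z22 w11 w12 w21 w22
    by (cases n) (simp add: el_eq_iff_same_vector)
  then show ?thesis
    by (auto simp: induced_eq_iff liftable_shear reduce_eq_iff)
qed

lemma induced_collapse_eq_iff:
  "induced (collapse l (a, b, c, d)) = induced (collapse l' (a', b', c', d')) \<longleftrightarrow>
    reduce l = reduce l' \<and>
    reduce a = reduce a' \<and> reduce b = reduce b' \<and> reduce c = reduce c' \<and> reduce d = reduce d'"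
proof -
  have "el (Cov m (- m) 0 0 z11 z12 z21 z22) = el (Cov m' (- m') 0 0 w11 w12 w21 w22) \<longleftrightarrow>
    int p dvd m - m' \<and>
    int p dvd z11 - w11 \<and> int p dvd z12 - w12 \<and> int p dvd z21 - w21 \<and> int p dvd z22 - w22" (is "?L \<longleftrightarrow> ?R")
    for m m' z11 z12 z21 z22 w11 w12 w21 w22
  proof
    assume ?L
    then obtain k1 k2 l1 l2 where k: "m = m' + int p * k1" "- m = - m' + int p * k2"
      "0 = 0 + int p * l1" "0 = 0 + int p * l2"
      "int p dvd z11 - w11 + k1 + k2" "int p dvd z12 - w12"
      "int p dvd z21 - w21 + l1" "int p dvd z22 - w22 + l1 + l2"
      unfolding el_eq_iff_coordinates by blast
    moreover have "l1 = 0" "l2 = 0" using k(3,4) p_pos by simp_all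
    \<comment> \<open>The first two coordinates are opposite, so their carries cancel and
      \<open>z11\<close> is compared without a carry.\<close>
    moreover have "int p * (k1 + k2) = 0" using k(1,2) by (simp add: algebra_simps)
    then have "k2 = - k1" using p_pos by simp
    ultimately show ?R by simp
  next
    assume R: ?R
    then obtain k where "m - m' = int p * k" by (auto elim: dvdE)
    then have "m = m' + int p * k" by simp
    with R show ?L
      unfolding el_eq_iff_coordinates
      by - (rule exI[of _ k], rule exI[of _ "-k"], rule exI[of _ 0], rule exI[of _ 0], simp)
  qed
  then show ?thesis
    by (auto simp: induced_eq_iff liftable_collapse reduce_eq_iff)
qed

text \<open>A shear fixes the centre and a collapse kills it; the element \<open>c11\<close>, which
  is not trivial, tells them apart.\<close>

lemma induced_shear_ne_collapse: "induced (shear q) \<noteq> induced (collapse l q')"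
proof
  obtain a b c d where q: "q = (a, b, c, d)" by (cases q)
  obtain a' b' c' d' where q': "q' = (a', b', c', d')" by (cases q')
  assume "induced (shear q) = induced (collapse l q')"
  then have "induced (shear q) (el (Cov 0 0 0 0 1 0 0 0)) = induced (collapse l q') (el (Cov 0 0 0 0 1 0 0 0))"
    by simp
  then have "el (Cov 0 0 0 0 1 0 0 0) = el (Cov 0 0 0 0 0 0 0 0)"
    by (simp add: induced_el liftable_shear liftable_collapse q q')
  then have "int p dvd 1" unfolding el_eq_iff_same_vector by simp
  then show False using prime by auto
qed

section \<open>Composition of endomorphisms and the automorphism group\<close>

lemma one_End: "\<one>\<^bsub>M\<^esub> = induced (shear (\<lambda>_. 0, \<lambda>_. 0, \<lambda>_. 0, \<lambda>_. 0))"
proof (rule End_eqI)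
  fix g
  show "\<one>\<^bsub>M\<^esub> (el (std g)) = induced (shear (\<lambda>_. 0, \<lambda>_. 0, \<lambda>_. 0, \<lambda>_. 0)) (el (std g))"
    using induced_el[OF liftable_shear, of "(\<lambda>_. 0, \<lambda>_. 0, \<lambda>_. 0, \<lambda>_. 0)"]
    by (simp add: End_monoid_def shear_zero del: shear.simps)
qed (simp_all add: induced_in_End liftable_shear)

lemma shear_mult_shear:
  "induced (shear (a, b, c, d)) \<otimes>\<^bsub>M\<^esub> induced (shear (a', b', c', d')) =
    induced (shear (\<lambda>g. a g + a' g, \<lambda>g. b g + b' g, \<lambda>g. c g + c' g, \<lambda>g. d g + d' g))"
  unfolding induced_mult[OF liftable_shear liftable_shear]
  by (rule arg_cong[of _ _ induced]) (simp add: fun_eq_iff shear_shear del: shear.simps)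

lemma collapse_mult_shear:
  "induced (collapse l q) \<otimes>\<^bsub>M\<^esub> induced (shear q') = induced (collapse l q)"
  unfolding induced_mult[OF liftable_collapse liftable_shear]
  by (rule arg_cong[of _ _ induced]) (simp add: fun_eq_iff collapse_shear del: shear.simps collapse.simps)

lemma shear_mult_collapse:
  "induced (shear (a', b', c', d')) \<otimes>\<^bsub>M\<^esub> induced (collapse l (a, b, c, d)) =
    induced (collapse l (\<lambda>g. a g + (a' A1 - a' A2) * l g, \<lambda>g. b g + (b' A1 - b' A2) * l g,
      \<lambda>g. c g + (c' A1 - c' A2) * l g, \<lambda>g. d g + (d' A1 - d' A2) * l g))"
  unfolding induced_mult[OF liftable_shear liftable_collapse]
  by (rule arg_cong[of _ _ induced]) (simp add: fun_eq_iff shear_collapse del: shear.simps collapse.simps)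

lemma shear_inverse:
  "induced (shear (a, b, c, d)) \<otimes>\<^bsub>M\<^esub> induced (shear (\<lambda>g. - a g, \<lambda>g. - b g, \<lambda>g. - c g, \<lambda>g. - d g)) = \<one>\<^bsub>M\<^esub>"
  "induced (shear (\<lambda>g. - a g, \<lambda>g. - b g, \<lambda>g. - c g, \<lambda>g. - d g)) \<otimes>\<^bsub>M\<^esub> induced (shear (a, b, c, d)) = \<one>\<^bsub>M\<^esub>"
  by (simp_all add: shear_mult_shear one_End del: shear.simps)

text \<open>A shear is inverted by negating its forms, while a collapse sends \<open>c11\<close> to
  the identity and so has no left inverse.\<close>

lemma End_Units: "Units M = range (\<lambda>q. induced (shear q))"
proof
  show "range (\<lambda>q. induced (shear q)) \<subseteq> Units M"
  proof (rule image_subsetI)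
    fix q :: quad
    obtain a b c d where "q = (a, b, c, d)" by (cases q)
    then show "induced (shear q) \<in> Units M"
      using shear_inverse[of a b c d] unfolding Units_def
      by (auto intro!: bexI[of _ "induced (shear (\<lambda>g. - a g, \<lambda>g. - b g, \<lambda>g. - c g, \<lambda>g. - d g))"]
          simp: induced_in_End liftable_shear simp del: shear.simps)
  qed
  show "Units M \<subseteq> range (\<lambda>q. induced (shear q))"
  proof
    fix \<phi> assume \<phi>: "\<phi> \<in> Units M"
    show "\<phi> \<in> range (\<lambda>q. induced (shear q))"
      using End_cases[OF M.Units_closed[OF \<phi>]]
    proof cases
      case (2 l q)
      obtain \<psi> where \<psi>: "\<psi> \<in> carrier M" "\<psi> \<otimes>\<^bsub>M\<^esub> \<phi> = \<one>\<^bsub>M\<^esub>"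
        using \<phi> by (auto simp: Units_def)
      have "\<psi> (\<phi> X) = X" if "X \<in> carrier G" for X
      proof -
        have "(\<psi> \<otimes>\<^bsub>M\<^esub> \<phi>) X = \<psi> (\<phi> X)" using that by (simp add: End_monoid_def compose_eq)
        then show ?thesis using that by (simp add: \<psi>(2)) (simp add: End_monoid_def)
      qed
      moreover have "\<phi> (el (Cov 0 0 0 0 1 0 0 0)) = \<phi> (el (Cov 0 0 0 0 0 0 0 0))"
        by (cases q) (simp add: 2 induced_el liftable_collapse)
      ultimately have "el (Cov 0 0 0 0 1 0 0 0) = el (Cov 0 0 0 0 0 0 0 0)"
        by (metis el_closed)
      then have "int p dvd 1" unfolding el_eq_iff_same_vector by simp
      then show ?thesis using prime by auto
    qed simp
  qed
qed

lemma inv_shear: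
  "inv\<^bsub>M\<^esub> induced (shear (a, b, c, d)) = induced (shear (\<lambda>g. - a g, \<lambda>g. - b g, \<lambda>g. - c g, \<lambda>g. - d g))"
  by (rule M.inv_unique'[symmetric])
    (simp_all add: shear_inverse induced_in_End liftable_shear del: shear.simps)

text \<open>Shears multiply by adding their forms and therefore commute.\<close>

lemma unit_conj_shear:
  "unit_conj M (induced (shear (a, b, c, d))) (induced (shear (a', b', c', d'))) = induced (shear (a', b', c', d'))"
  by (simp add: unit_conj_def induced_in_End liftable_shear inv_shear shear_mult_shear del: shear.simps)

text \<open>The inverse on the right is swallowed by \<open>collapse_mult_shear\<close>, so
  conjugation is just multiplication from the left.\<close>

lemma unit_conj_collapse:
  "unit_conj M (induced (shear (a', b', c', d'))) (induced (collapse l (a, b, c, d))) =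
    induced (collapse l (\<lambda>g. a g + (a' A1 - a' A2) * l g, \<lambda>g. b g + (b' A1 - b' A2) * l g,
      \<lambda>g. c g + (c' A1 - c' A2) * l g, \<lambda>g. d g + (d' A1 - d' A2) * l g))"
  by (simp add: unit_conj_def induced_in_End liftable_collapse inv_shear shear_mult_collapse
      collapse_mult_shear del: shear.simps collapse.simps)

section \<open>Orbits, their lengths and their number\<close>

abbreviation orb where "orb \<equiv> orbit (Aut_group G) (unit_conj M)"

lemma orb_eq: "orb \<phi> = (\<lambda>q. unit_conj M (induced (shear q)) \<phi>) ` UNIV"
  by (auto simp: orbit_def units_of_carrier End_Units)

lemma orb_shear: "orb (induced (shear q)) = {induced (shear q)}"
proof -
  have "unit_conj M (induced (shear q')) (induced (shear q)) = induced (shear q)" for q'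
    by (cases q; cases q') (simp only: unit_conj_shear)
  then show ?thesis by (auto simp: orb_eq)
qed

lemma orb_collapse:
  "orb (induced (collapse l (a, b, c, d))) =
    {induced (collapse l (\<lambda>g. a g + i * l g, \<lambda>g. b g + j * l g, \<lambda>g. c g + k * l g, \<lambda>g. d g + m * l g)) | i j k m. True}"
  (is "?L = ?R")
proof
  show "?L \<subseteq> ?R"
  proof
    fix \<psi> assume "\<psi> \<in> ?L"
    then obtain a' b' c' d' where
      "\<psi> = unit_conj M (induced (shear (a', b', c', d'))) (induced (collapse l (a, b, c, d)))"
      by (auto simp: orb_eq)
    then show "\<psi> \<in> ?R" unfolding unit_conj_collapse by blast
  qed
  show "?R \<subseteq> ?L"
  proof
    fix \<psi> assume "\<psi> \<in> ?R"
    then obtain i j k m where \<psi>: "\<psi> = induced (collapse l (\<lambda>g. a g + i * l g, \<lambda>g. b g + j * l g, \<lambda>g. c g + k * l g, \<lambda>g. d g + m * l g))"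
      by blast
    \<comment> \<open>This form has value \<open>t\<close> on \<open>a1 - a2\<close>, so the four
      shifts can be prescribed independently.\<close>
    define e where "e t = (\<lambda>g. if g = A1 then t else 0)" for t :: int
    have "\<psi> = unit_conj M (induced (shear (e i, e j, e k, e m))) (induced (collapse l (a, b, c, d)))"
      unfolding unit_conj_collapse \<psi> by (simp add: e_def del: collapse.simps)
    then show "\<psi> \<in> ?L" unfolding orb_eq by (rule image_eqI) simp
  qed
qed

text \<open>Some value \<open>l g\<close> is invertible modulo \<open>p\<close>, so each of the four
  shifts can be recovered modulo \<open>p\<close> from the shifted form.\<close>

lemma card_orb_collapse:
  assumes l: "l \<in> residue_funs" "l \<noteq> (\<lambda>_. 0)"
  shows "card (orb (induced (collapse l (a, b, c, d)))) = p ^ 4"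
proof -
  define f where "f = (\<lambda>(i, j, k, m). induced (collapse l
    (\<lambda>g. a g + i * l g, \<lambda>g. b g + j * l g, \<lambda>g. c g + k * l g, \<lambda>g. d g + m * l g)))"
  let ?I = "{0..<int p}"
  obtain g where "l g \<noteq> 0" using l(2) by auto
  moreover have "0 \<le> l g" "l g < int p"
    using l(1) by (auto simp: residue_funs_def PiE_def Pi_iff)
  ultimately have g: "\<not> int p dvd l g"
    using zdvd_not_zless by force
  have reduce_iff: "reduce (\<lambda>g. a g + i * l g) = reduce (\<lambda>g. a g + i' * l g) \<longleftrightarrow> i mod int p = i' mod int p"
    for a :: "jk_gen \<Rightarrow> int" and i i' :: int
  proof -
    have "reduce (\<lambda>g. a g + i * l g) = reduce (\<lambda>g. a g + i' * l g) \<longleftrightarrow> (\<forall>g. int p dvd (i - i') * l g)"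
      by (simp add: reduce_eq_iff algebra_simps)
    also have "\<dots> \<longleftrightarrow> int p dvd i - i'"
      using g prime by (auto simp: prime_dvd_mult_iff)
    finally show ?thesis by (simp add: mod_eq_dvd_iff)
  qed
  have eq: "f (i, j, k, m) = f (i', j', k', m') \<longleftrightarrow>
      i mod int p = i' mod int p \<and> j mod int p = j' mod int p \<and> k mod int p = k' mod int p \<and> m mod int p = m' mod int p"
    for i j k m i' j' k' m'
    by (simp add: f_def induced_collapse_eq_iff reduce_iff del: collapse.simps)
  have "orb (induced (collapse l (a, b, c, d))) = f ` (?I \<times> ?I \<times> ?I \<times> ?I)"
  proof
    show "orb (induced (collapse l (a, b, c, d))) \<subseteq> f ` (?I \<times> ?I \<times> ?I \<times> ?I)"
    proof
      fix \<psi> assume "\<psi> \<in> orb (induced (collapse l (a, b, c, d)))"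
      then obtain i j k m where "\<psi> = f (i, j, k, m)"
        by (auto simp: orb_collapse f_def simp del: collapse.simps)
      also have "\<dots> = f (i mod int p, j mod int p, k mod int p, m mod int p)"
        by (simp add: eq)
      finally show "\<psi> \<in> f ` (?I \<times> ?I \<times> ?I \<times> ?I)"
        by (rule image_eqI) (use p_pos in simp)
    qed
  qed (auto simp: orb_collapse f_def simp del: collapse.simps)
  moreover have "inj_on f (?I \<times> ?I \<times> ?I \<times> ?I)"
    by (rule inj_onI) (clarsimp simp: eq)
  ultimately show ?thesis
    by (simp add: card_image card_cartesian_product flip: power_Suc)
      (simp add: power_numeral_reduce)
qed

text \<open>In this and the next two sets the forms are residue representatives, so that every
  endomorphism is parametrised exactly once; the split is by \<open>T = 1\<close>,
  \<open>T = 0\<close> and \<open>l\<close> nonzero.\<close>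

definition autos where "autos = (\<lambda>q. induced (shear q)) ` quads"
definition centrals where "centrals = (\<lambda>q. induced (collapse (\<lambda>_. 0) q)) ` quads"
definition others where
  "others = (\<lambda>(l, q). induced (collapse l q)) ` ((residue_funs - {\<lambda>_. 0}) \<times> quads)"

lemma zero_in_residue_funs: "(\<lambda>_. 0) \<in> residue_funs"
  using reduce_in_residue_funs[of "\<lambda>_. 0"] by (simp add: reduce_def)

lemma card_autos: "card autos = p ^ 16"
proof -
  have "inj_on (\<lambda>q. induced (shear q)) quads"
    by (rule inj_onI) (clarsimp simp: induced_shear_eq_iff simp del: shear.simps)
  then show ?thesis unfolding autos_def by (simp only: card_image card_quads)
qed

lemma card_centrals: "card centrals = p ^ 16"
proof -
  have "inj_on (\<lambda>q. induced (collapse (\<lambda>_. 0) q)) quads"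
    by (rule inj_onI) (clarsimp simp: induced_collapse_eq_iff simp del: collapse.simps)
  then show ?thesis unfolding centrals_def by (simp only: card_image card_quads)
qed

lemma card_others: "card others = (p ^ 4 - 1) * p ^ 16"
proof -
  have "inj_on (\<lambda>(l, q). induced (collapse l q)) ((residue_funs - {\<lambda>_. 0}) \<times> quads)"
    by (rule inj_onI) (clarsimp simp: induced_collapse_eq_iff simp del: collapse.simps)
  moreover have "card (residue_funs - {\<lambda>_. 0}) = p ^ 4 - 1"
    using zero_in_residue_funs by (simp add: card_Diff_singleton card_residue_funs)
  ultimately show ?thesis
    unfolding others_def by (simp only: card_image card_cartesian_product[of _ quads] card_quads)
qed

lemma finite_sets: "finite autos" "finite centrals" "finite others"
  by (simp_all add: autos_def centrals_def others_def finite_residue_funs)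

lemma shear_in_autos: "induced (shear q) \<in> autos"
proof -
  obtain a b c d where q: "q = (a, b, c, d)" by (cases q)
  have "induced (shear q) = induced (shear (reduce a, reduce b, reduce c, reduce d))"
    unfolding q by (simp add: induced_shear_eq_iff del: shear.simps)
  then show ?thesis unfolding autos_def by (rule image_eqI) simp
qed

lemma collapse_in_others:
  assumes "l \<in> residue_funs" "l \<noteq> (\<lambda>_. 0)"
  shows "induced (collapse l q) \<in> others"
proof -
  obtain a b c d where q: "q = (a, b, c, d)" by (cases q)
  have "induced (collapse l q) = (\<lambda>(l, q). induced (collapse l q)) (l, (reduce a, reduce b, reduce c, reduce d))"
    unfolding q by (simp add: induced_collapse_eq_iff del: collapse.simps)
  then show ?thesis unfolding others_def by (rule image_eqI) (use assms in simp)
qed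

lemma collapse_in: "induced (collapse l q) \<in> centrals \<union> others"
proof -
  obtain a b c d where q: "q = (a, b, c, d)" by (cases q)
  have *: "induced (collapse l q) = induced (collapse (reduce l) (reduce a, reduce b, reduce c, reduce d))"
    unfolding q by (simp add: induced_collapse_eq_iff del: collapse.simps)
  show ?thesis
  proof (cases "reduce l = (\<lambda>_. 0)")
    case True
    then show ?thesis unfolding * centrals_def by simp
  next
    case False
    then show ?thesis unfolding * using collapse_in_others[of "reduce l"] by simp
  qed
qed

lemma carrier_End: "carrier M = (autos \<union> centrals) \<union> others"
proof
  show "carrier M \<subseteq> (autos \<union> centrals) \<union> others"
  proof
    fix \<phi> assume "\<phi> \<in> carrier M"
    then show "\<phi> \<in> (autos \<union> centrals) \<union> others"
      by (cases rule: End_cases) (use shear_in_autos collapse_in in auto)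
  qed
  show "(autos \<union> centrals) \<union> others \<subseteq> carrier M"
    by (auto simp: autos_def centrals_def others_def intro!: induced_in_End liftable_shear liftable_collapse
        simp del: shear.simps collapse.simps)
qed

lemma autos_disjoint: "autos \<inter> centrals = {}"
  by (auto simp: autos_def centrals_def induced_shear_ne_collapse simp del: shear.simps collapse.simps)

lemma orb_singleton:
  assumes "\<phi> \<in> autos \<union> centrals"
  shows "orb \<phi> = {\<phi>}"
  using assms
proof
  assume "\<phi> \<in> autos"
  then show ?thesis by (auto simp: autos_def orb_shear simp del: shear.simps)
next
  assume "\<phi> \<in> centrals"
  then show ?thesis by (auto simp: centrals_def orb_collapse simp del: collapse.simps)
qed

lemma othersE:
  assumes "\<phi> \<in> others"
  obtains l a b c d where "\<phi> = induced (collapse l (a, b, c, d))" "l \<in> residue_funs" "l \<noteq> (\<lambda>_. 0)"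
proof -
  obtain x where \<phi>: "\<phi> = (\<lambda>(l, q). induced (collapse l q)) x"
    and x: "x \<in> (residue_funs - {\<lambda>_. 0}) \<times> quads"
    using assms unfolding others_def by (rule imageE)
  obtain l a b c d where "x = (l, a, b, c, d)" by (cases x)
  with \<phi> x show ?thesis by (intro that[of l a b c d]) simp_all
qed

lemma card_orb_others:
  assumes "\<phi> \<in> others"
  shows "card (orb \<phi>) = p ^ 4"
  using assms by (rule othersE) (use card_orb_collapse in blast)

lemma orb_others_subset: "\<phi> \<in> others \<Longrightarrow> orb \<phi> \<subseteq> others"
proof -
  assume "\<phi> \<in> others"
  then obtain l a b c d where "\<phi> = induced (collapse l (a, b, c, d))" "l \<in> residue_funs" "l \<noteq> (\<lambda>_. 0)"
    by (rule othersE)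
  then show ?thesis
    by (auto simp: orb_collapse intro!: collapse_in_others simp del: collapse.simps)
qed

lemma conj_orbits_eq: "conj_orbits G = (\<lambda>\<phi>. {\<phi>}) ` (autos \<union> centrals) \<union> orb ` others"
proof -
  have "conj_orbits G = orb ` (autos \<union> centrals) \<union> orb ` others"
    unfolding conj_orbits_def orbits_def carrier_End by blast
  also have "orb ` (autos \<union> centrals) = (\<lambda>\<phi>. {\<phi>}) ` (autos \<union> centrals)"
    by (rule image_cong) (simp_all add: orb_singleton)
  finally show ?thesis .
qed

lemma card_singleton_orbits: "card ((\<lambda>\<phi>. {\<phi>}) ` (autos \<union> centrals)) = 2 * p ^ 16"
proof -
  have "card ((\<lambda>\<phi>. {\<phi>}) ` (autos \<union> centrals)) = card (autos \<union> centrals)"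
    by (rule card_image) simp
  also have "\<dots> = 2 * p ^ 16"
    using finite_sets by (simp add: card_Un_disjoint autos_disjoint card_autos card_centrals)
  finally show ?thesis .
qed

text \<open>The orbits partition \<open>others\<close>, which has
  \<open>(p ^ 4 - 1) * p ^ 16\<close> elements, into blocks of size \<open>p ^ 4\<close>.\<close>

lemma card_other_orbits: "card (orb ` others) = p ^ 12 * (p ^ 4 - 1)"
proof -
  interpret act: group_action "Aut_group G" "carrier M" "unit_conj M"
    by (rule group_action_JK_group)
  have sub: "orb ` others \<subseteq> orbits (Aut_group G) (carrier M) (unit_conj M)"
    unfolding orbits_def carrier_End by blast
  have Un: "\<Union> (orb ` others) = others"
    using orb_others_subset act.orbit_refl unfolding carrier_End by blast
  have "p ^ 4 * card (orb ` others) = card (\<Union> (orb ` others))"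
  proof (rule card_partition)
    show "finite (orb ` others)" using finite_sets by simp
    show "finite (\<Union> (orb ` others))" unfolding Un by (rule finite_sets)
    show "card C = p ^ 4" if "C \<in> orb ` others" for C
      using that card_orb_others by auto
    show "C \<inter> D = {}" if "C \<in> orb ` others" "D \<in> orb ` others" "C \<noteq> D" for C D
      using act.disjoint_union[of C D] that sub by blast
  qed
  also have "\<dots> = p ^ 4 * (p ^ 12 * (p ^ 4 - 1))"
    unfolding Un card_others by (simp add: flip: power_add mult.assoc)
  finally show ?thesis using p_pos by (simp only: mult_cancel1) simp
qed

lemma orbit_counts:
  "card (conj_orbits G) = 3 * p ^ 16 - p ^ 12"
  "card {\<O> \<in> conj_orbits G. card \<O> = 1} = 2 * p ^ 16"
  "card {\<O> \<in> conj_orbits G. card \<O> = p ^ 4} = p ^ 12 * (p ^ 4 - 1)"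
proof -
  define S T where "S = (\<lambda>\<phi>. {\<phi>}) ` (autos \<union> centrals)" and "T = orb ` others"
  have eq: "conj_orbits G = S \<union> T"
    by (simp only: conj_orbits_eq S_def T_def)
  have cards: "card S = 2 * p ^ 16" "card T = p ^ 12 * (p ^ 4 - 1)"
    by (simp_all only: S_def T_def card_singleton_orbits card_other_orbits)
  have fin: "finite S" "finite T"
    using finite_sets by (simp_all add: S_def T_def)
  have S: "card C = 1" if "C \<in> S" for C
    using that unfolding S_def by auto
  have T: "card C = p ^ 4" if "C \<in> T" for C
    using that card_orb_others unfolding T_def by blast
  \<comment> \<open>The two orbit lengths differ, so length alone separates \<open>S\<close> from
    \<open>T\<close>.\<close>
  have "1 < p ^ 4"
    using prime_gt_1_nat[OF prime] by (intro one_less_power) simp_all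
  then have ne: "p ^ 4 \<noteq> 1" by linarith
  have "S \<inter> T = {}" using S T ne by fastforce
  then have "card (conj_orbits G) = 2 * p ^ 16 + p ^ 12 * (p ^ 4 - 1)"
    by (simp only: eq card_Un_disjoint fin cards)
  also have "\<dots> = 2 * p ^ 16 + (p ^ 16 - p ^ 12)"
    by (simp add: diff_mult_distrib2 flip: power_add)
  \<comment> \<open>Subtraction of natural numbers is truncated; \<open>p ^ 12 \<le> p ^ 16\<close>
    justifies the regrouping.\<close>
  also have "\<dots> = 3 * p ^ 16 - p ^ 12"
    using power_increasing[of 12 16 p] p_pos by simp
  finally show "card (conj_orbits G) = 3 * p ^ 16 - p ^ 12" .
  have "{\<O> \<in> conj_orbits G. card \<O> = 1} = S"
    unfolding eq using S T ne by fastforce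
  then show "card {\<O> \<in> conj_orbits G. card \<O> = 1} = 2 * p ^ 16"
    by (simp only: cards)
  have "{\<O> \<in> conj_orbits G. card \<O> = p ^ 4} = T"
    unfolding eq using T by auto (metis S ne)
  then show "card {\<O> \<in> conj_orbits G. card \<O> = p ^ 4} = p ^ 12 * (p ^ 4 - 1)"
    by (simp only: cards)
qed

end

theorem corollary2:
  fixes p :: nat
  assumes "prime p"
  shows "card (conj_orbits (JK_group p)) = 3 * p ^ 16 - p ^ 12 \<and>
    card {\<O> \<in> conj_orbits (JK_group p). card \<O> = 1} = 2 * p ^ 16 \<and>
    card {\<O> \<in> conj_orbits (JK_group p). card \<O> = p ^ 4} = p ^ 12 * (p ^ 4 - 1)"
proof -
  interpret jk p by standard (rule assms)
  show ?thesis using orbit_counts by blast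
qed

end
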